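(* Let $\{r_n\}_{n\in\mathbb{N}}$ be a sequence of real numbers. (1) If $\{r_n\}_{n\in\mathbb{N}}$ is uniformly right-c.e., then there is a right-c.e. real $r$ such that the join of the left Dedekind cuts of the $r_n$'s is enumeration-equivalent to the left Dedekind cut of $r$. (2) If $\{r_n\}_{n\in\mathbb{N}}$ is uniformly left-c.e., then there is a left-c.e. real $r$ such that the join of the right Dedekind cuts of the $r_n$'s is enumeration-equivalent to the right Dedekind cut of $r$.
   Context: The left Dedekind cut of a real $x$ is $\{q\in\mathbb{Q}:q<x\}$ and the right Dedekind cut is $\{q\in\mathbb{Q}:q>x\}$. A real is left-c.e. (right-c.e.) if its left (right) Dedekind cut is c.e.; a sequence of reals is uniformly left-c.e. (right-c.e.) if the left (right) Dedekind cut of $r_n$ is c.e. uniformly in $n$. The join of sets $A_n$ is $\bigoplus_n A_n=\{\langle n,x\rangle: x\in A_n\}$ for a computable pairing function. Enumeration-equivalence means mutual enumeration reducibility. *)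

theory Defs
  imports Complex_Main "HOL-Library.Nat_Bijection" "HOL-Library.Countable"
begin

text \<open>
  Terms for the partial recursive functions (Kleene's schemata). A term carries no arity; for
  every \<open>k\<close> it denotes a \<open>k\<close>-ary partial function on argument lists of length \<open>k\<close>, undefined
  where no rule of the evaluation relation below applies.
\<close>

datatype recf =
    Zero
  | Succ
  | Proj nat
  | Comp recf "recf list"
  | PRec recf recf
  | Mu recf

inductive computes :: "recf \<Rightarrow> nat list \<Rightarrow> nat \<Rightarrow> bool" where
  Zero: "computes Zero xs 0"
| Succ: "computes Succ [x] (Suc x)"
| Proj: "i < length xs \<Longrightarrow> computes (Proj i) xs (xs ! i)"
| Comp: "list_all2 (\<lambda>g y. computes g xs y) gs ys \<Longrightarrow> computes f ys z \<Longrightarrow>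
    computes (Comp f gs) xs z"
| PRec_0: "computes f xs y \<Longrightarrow> computes (PRec f g) (0 # xs) y"
| PRec_Suc: "computes (PRec f g) (n # xs) y \<Longrightarrow> computes g (n # y # xs) z \<Longrightarrow>
    computes (PRec f g) (Suc n # xs) z"
| Mu: "computes f (n # xs) 0 \<Longrightarrow> (\<forall>m<n. \<exists>y. computes f (m # xs) (Suc y)) \<Longrightarrow>
    computes (Mu f) xs n"

lemma computes_deterministic:
  "computes f xs y \<Longrightarrow> computes f xs z \<Longrightarrow> y = z"
proof (induction arbitrary: z rule: computes.induct)
  case (Zero xs)
  then show ?case by cases simp_all
next
  case (Succ x)
  then show ?case by cases simp_all
next
  case (Proj i xs)
  from Proj.prems show ?case by cases simp_all
next
  case (Comp xs gs ys f w)
  from Comp.prems obtain ys' where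
    ys': "list_all2 (\<lambda>g y. computes g xs y) gs ys'" and f: "computes f ys' z"
    by cases simp_all
  have "ys = ys'"
    using Comp.IH(1) ys' unfolding list_all2_conv_all_nth by (metis nth_equalityI)
  with Comp.IH f show ?case by blast
next
  case (PRec_0 f xs y g)
  from PRec_0.prems have "computes f xs z" by cases simp_all
  with PRec_0.IH show ?case by blast
next
  case (PRec_Suc f g n xs y w)
  from PRec_Suc.prems obtain y' where
    "computes (PRec f g) (n # xs) y'" "computes g (n # y' # xs) z"
    by cases simp_all
  with PRec_Suc.IH show ?case by blast
next
  case (Mu f n xs)
  from Mu.prems have z: "computes f (z # xs) 0" "\<forall>m<z. \<exists>y. computes f (m # xs) (Suc y)"
    by (cases; simp)+
  consider "n < z" | "n = z" | "z < n" by linarith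
  then show ?case
  proof cases
    case 1
    with z(2) obtain y where "computes f (n # xs) (Suc y)" by blast
    with Mu.IH(1) have "0 = Suc y" by blast
    then show ?thesis by simp
  next
    case 3
    with Mu.IH(2) obtain y where "\<And>z'. computes f (z # xs) z' \<Longrightarrow> Suc y = z'" by blast
    with z(1) have "Suc y = 0" by blast
    then show ?thesis by simp
  qed
qed

definition ce :: "nat set \<Rightarrow> bool" where
  "ce A \<longleftrightarrow> (\<exists>f. A = {x. \<exists>y. computes f [x] y})"

definition uniformly_ce :: "(nat \<Rightarrow> nat set) \<Rightarrow> bool" where
  "uniformly_ce A \<longleftrightarrow> (\<exists>f. \<forall>n. A n = {x. \<exists>y. computes f [n, x] y})"

text \<open>Finite sets are given by their canonical indices \<open>set_encode D = (\<Sum>i\<in>D. 2 ^ i)\<close>.\<close>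

definition enum_reducible :: "nat set \<Rightarrow> nat set \<Rightarrow> bool" where
  "enum_reducible A B \<longleftrightarrow>
    (\<exists>W. ce W \<and> A = {x. \<exists>D. finite D \<and> D \<subseteq> B \<and> prod_encode (x, set_encode D) \<in> W})"

definition enum_equivalent :: "nat set \<Rightarrow> nat set \<Rightarrow> bool" where
  "enum_equivalent A B \<longleftrightarrow> enum_reducible A B \<and> enum_reducible B A"

definition join :: "(nat \<Rightarrow> nat set) \<Rightarrow> nat set" where
  "join A = {prod_encode (n, x) | n x. x \<in> A n}"

text \<open>
  Sets of rationals become sets of natural numbers through the computable numbering
  \<open>nat_to_rat_surj\<close>, which takes the code of a pair of integers to their quotient (to \<open>0\<close>
  if the denominator is \<open>0\<close>). It is onto but not injective, so a set of rationals is represented by all codes of its elements.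
  The cuts are strict on both sides, so a rational \<open>x\<close> lies in neither of its own cuts.
\<close>

definition rat_codes :: "rat set \<Rightarrow> nat set" where
  "rat_codes Q = {n. nat_to_rat_surj n \<in> Q}"

definition left_cut :: "real \<Rightarrow> rat set" where
  "left_cut x = {q. of_rat q < x}"

definition right_cut :: "real \<Rightarrow> rat set" where
  "right_cut x = {q. of_rat q > x}"

definition left_ce :: "real \<Rightarrow> bool" where
  "left_ce x \<longleftrightarrow> ce (rat_codes (left_cut x))"

definition right_ce :: "real \<Rightarrow> bool" where
  "right_ce x \<longleftrightarrow> ce (rat_codes (right_cut x))"

definition uniformly_left_ce :: "(nat \<Rightarrow> real) \<Rightarrow> bool" where
  "uniformly_left_ce r \<longleftrightarrow> uniformly_ce (\<lambda>n. rat_codes (left_cut (r n)))"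

definition uniformly_right_ce :: "(nat \<Rightarrow> real) \<Rightarrow> bool" where
  "uniformly_right_ce r \<longleftrightarrow> uniformly_ce (\<lambda>n. rat_codes (right_cut (r n)))"

end

theory Submission
  imports Defs
begin

text \<open>
  After an increasing computable homeomorphism from the line onto \<open>(0, 1)\<close>, which carries \<open>r\<^sub>n\<close> to
  \<open>u\<^sub>n\<close>, take \<open>s = (\<Sum>n. 2\<^sup>-\<^sup>n\<^sup>-\<^sup>1 u\<^sub>n)\<close>. Summing upper approximations of the \<open>u\<^sub>n\<close> gives upper
  approximations of \<open>s\<close>, so \<open>s\<close> is right-c.e.; summing finitely many lower bounds enumerates the
  left cut of \<open>s\<close> from those of the \<open>u\<^sub>n\<close>. Conversely, \<open>q < u\<^sub>n\<close> holds iff some rational \<open>p < s\<close>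
  exceeds what an upper approximation of \<open>s\<close> becomes when its \<open>n\<close>-th term is replaced by
  \<open>2\<^sup>-\<^sup>n\<^sup>-\<^sup>1 q\<close>.
  Left-c.e. sequences reduce to this case by negation, provided that the numbering of the rationals
  is kept as a parameter.
\<close>

section \<open>Total recursive functions\<close>

text \<open>A single left cut yields only lower bounds for the sum, which seems to blur the terms.
  The term \<open>u n\<close> can still be isolated because upper bounds for all other terms are
  computable from the enumeration of the right cuts; only lower information has to pass through the
  oracle. Working in (0, 1) supplies the default bounds 0 and 1 for terms about which nothing is
  known yet, and weights of total mass one leave at most \<open>(1 / 2) ^ n\<close> for everything
  from term \<open>n\<close> on. The second difficulty is the model of computation: a c.e. set is
  the domain of one term, and the schemata offer no direct way to run partial computations side by
  side. Each term therefore receives its own total recursive evaluator with a time budget, built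
  along the structure of the term in place of a universal function. Rational arithmetic is done on
  values rather than codes: numbers are fractions of recursive functions and are never encoded back
  as rationals.\<close>

definition recursive :: "nat \<Rightarrow> (nat list \<Rightarrow> nat) \<Rightarrow> bool" where
  "recursive k F \<longleftrightarrow> (\<exists>e. \<forall>xs. length xs = k \<longrightarrow> computes e xs (F xs))"

definition decidable :: "nat \<Rightarrow> (nat list \<Rightarrow> bool) \<Rightarrow> bool" where
  "decidable k P \<longleftrightarrow> recursive k (\<lambda>xs. of_bool (P xs))"

text \<open>The closure rules speak about functions of one argument list, so that
  \<open>intro rec_intros\<close> proves recursiveness by following the syntax of an
  expression.\<close>

named_theorems rec_intros

lemma recursive_cong:
  assumes "recursive k F" "\<And>xs. length xs = k \<Longrightarrow> F xs = G xs"
  shows "recursive k G"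
  using assms unfolding recursive_def by metis

lemma recursive_subst:
  assumes "recursive (length Gs) F" "\<And>G. G \<in> set Gs \<Longrightarrow> recursive k G"
  shows "recursive k (\<lambda>xs. F (map (\<lambda>G. G xs) Gs))"
proof -
  obtain f where f: "\<And>xs. length xs = length Gs \<Longrightarrow> computes f xs (F xs)"
    using assms(1) unfolding recursive_def by blast
  obtain g where g: "\<And>G xs. G \<in> set Gs \<Longrightarrow> length xs = k \<Longrightarrow> computes (g G) xs (G xs)"
    using assms(2) unfolding recursive_def by metis
  have "computes (Comp f (map g Gs)) xs (F (map (\<lambda>G. G xs) Gs))" if "length xs = k" for xs
    using f g that
    by (intro Comp[where ys = "map (\<lambda>G. G xs) Gs"]) (auto simp: list_all2_conv_all_nth)
  then show ?thesis unfolding recursive_def by blast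
qed

lemma recursive_proj [rec_intros]: "i < k \<Longrightarrow> recursive k (\<lambda>xs. xs ! i)"
  unfolding recursive_def using Proj by metis

text \<open>Recursion and search put their bound variables in front of the argument list, so that
  outer arguments reappear behind one or two \<open>tl\<close>.\<close>

lemma recursive_proj_tl [rec_intros]: "Suc i < k \<Longrightarrow> recursive k (\<lambda>xs. tl xs ! i)"
  by (rule recursive_cong[OF recursive_proj]) (auto simp: nth_tl)

lemma recursive_proj_tl_tl [rec_intros]:
  "Suc (Suc i) < k \<Longrightarrow> recursive k (\<lambda>xs. tl (tl xs) ! i)"
  by (rule recursive_cong[OF recursive_proj]) (auto simp: nth_tl)

lemma recursive_reindex:
  assumes "recursive (length js) F" "\<And>i. i \<in> set js \<Longrightarrow> i < k"
  shows "recursive k (\<lambda>xs. F (map ((!) xs) js))"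
  using recursive_subst[of "map (\<lambda>i xs. xs ! i) js" F k] assms
  by (auto simp: comp_def intro: recursive_proj)

lemma map_nth_upt_length: "map ((!) xs) [m..<length xs] = drop m xs"
  by (intro nth_equalityI) auto

lemma recursive_tl:
  assumes "recursive k F"
  shows "recursive (Suc k) (\<lambda>xs. F (tl xs))"
proof (rule recursive_cong[OF recursive_reindex[where F = F and
      js = "[1..<Suc k]"]])
  show "F (map ((!) xs) [1..<Suc k]) = F (tl xs)" if "length xs = Suc k" for xs
    using map_nth_upt_length[of xs 1] that by (simp add: drop_Suc del: upt_Suc)
qed (use assms in \<open>auto simp del: upt_Suc\<close>)

text \<open>In the step of a primitive recursion the list is counter, previous value, parameters.
  Dropping the second entry adapts functions that ignore the previous value.\<close>

lemma recursive_Cons_tl_tl: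
  assumes "recursive (Suc k) F"
  shows "recursive (Suc (Suc k)) (\<lambda>xs. F (xs ! 0 # tl (tl xs)))"
proof (rule recursive_cong[OF recursive_reindex[where F = F and
      js = "0 # [Suc (Suc 0)..<Suc (Suc k)]"]])
  show "F (map ((!) xs) (0 # [Suc (Suc 0)..<Suc (Suc k)])) = F (xs ! 0 # tl (tl xs))"
    if "length xs = Suc (Suc k)" for xs
    using map_nth_upt_length[of xs 2] that by (simp add: drop_Suc numeral_2_eq_2 del: upt_Suc)
qed (use assms in \<open>auto simp del: upt_Suc\<close>)

lemma recursive_subst_Cons:
  assumes "recursive (Suc k) F" "recursive k a"
  shows "recursive k (\<lambda>xs. F (a xs # xs))"
proof (rule recursive_cong[OF recursive_subst[where F = F and
      Gs = "a # map (\<lambda>i xs. xs ! i) [0..<k]"]])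
  show "F (map (\<lambda>G. G xs) (a # map (\<lambda>i xs. xs ! i) [0..<k])) = F (a xs # xs)"
    if "length xs = k" for xs
    using map_nth[of xs] that by (simp add: comp_def)
qed (use assms in \<open>auto intro: recursive_proj\<close>)

lemma recursive_Suc [rec_intros]:
  assumes "recursive k f"
  shows "recursive k (\<lambda>xs. Suc (f xs))"
proof -
  have "recursive (length [f]) (\<lambda>ys. Suc (ys ! 0))"
    unfolding recursive_def by (rule exI[where x = Succ]) (auto simp: length_Suc_conv intro: Succ)
  from recursive_subst[OF this, of k] assms show ?thesis by simp
qed

lemma recursive_const [rec_intros]: "recursive k (\<lambda>xs. c)"
proof (induction c)
  case 0
  show ?case unfolding recursive_def using Zero by blast
qed (rule recursive_Suc)

lemma recursive_rec_nat [rec_intros]: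
  assumes "recursive k f" "recursive (Suc (Suc k)) (\<lambda>ys. g (ys ! 0) (ys ! 1) (tl (tl ys)))"
    and "recursive k a"
  shows "recursive k (\<lambda>xs. rec_nat (f xs) (\<lambda>n y. g n y xs) (a xs))"
proof -
  obtain ef eg where e: "\<And>xs. length xs = k \<Longrightarrow> computes ef xs (f xs)"
    "\<And>xs. length xs = Suc (Suc k) \<Longrightarrow> computes eg xs (g (xs ! 0) (xs ! 1) (tl (tl xs)))"
    using assms unfolding recursive_def by metis
  have "computes (PRec ef eg) (n # xs) (rec_nat (f xs) (\<lambda>n y. g n y xs) n)"
    if "length xs = k" for n xs
  proof (induction n)
    case (Suc n)
    then show ?case using e(2)[of "n # rec_nat (f xs) (\<lambda>n y. g n y xs) n # xs"] that
      by (auto intro: PRec_Suc)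
  qed (use e that in \<open>auto intro: PRec_0\<close>)
  then have "recursive (Suc k) (\<lambda>ys. rec_nat (f (tl ys)) (\<lambda>n y. g n y (tl ys)) (hd ys))"
    unfolding recursive_def by (intro exI[where x = "PRec ef eg"]) (auto simp: length_Suc_conv)
  from recursive_subst_Cons[OF this assms(3)] show ?thesis by simp
qed

section \<open>Arithmetic, decidable relations, search and pairing\<close>

lemma recursive_add [rec_intros]:
  assumes "recursive k f" "recursive k g"
  shows "recursive k (\<lambda>xs. f xs + g xs)"
proof -
  have eq: "rec_nat a (\<lambda>_. Suc) b = a + b" for a b :: nat by (induction b) auto
  show ?thesis
    by (rule recursive_cong[OF recursive_rec_nat[where f = f and g = "\<lambda>_ y _. Suc y"
          and a = g and k = k]])
      (use eq assms in \<open>auto intro!: rec_intros\<close>)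
qed

lemma recursive_mult [rec_intros]:
  assumes "recursive k f" "recursive k g"
  shows "recursive k (\<lambda>xs. f xs * g xs)"
proof -
  have eq: "rec_nat 0 (\<lambda>_ y. y + a) b = a * b" for a b :: nat by (induction b) auto
  show ?thesis
    by (rule recursive_cong[OF recursive_rec_nat[where f = "\<lambda>_. 0" and g = "\<lambda>_ y xs. y + f xs"
          and a = g and k = k]])
      (use eq assms in \<open>auto intro!: rec_intros recursive_tl\<close>)
qed

lemma recursive_diff [rec_intros]:
  assumes "recursive k f" "recursive k g"
  shows "recursive k (\<lambda>xs. f xs - g xs)"
proof -
  have pred: "recursive k (\<lambda>xs. h xs - 1)" if "recursive k h" for k h
  proof -
    have eq: "rec_nat 0 (\<lambda>n _. n) b = b - 1" for b :: nat by (cases b) auto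
    show ?thesis
      by (rule recursive_cong[OF recursive_rec_nat[where f = "\<lambda>_. 0" and g = "\<lambda>n _ _. n"
            and a = h and k = k]])
        (use eq that in \<open>auto intro!: rec_intros\<close>)
  qed
  have eq: "rec_nat a (\<lambda>_ y. y - 1) b = a - b" for a b :: nat by (induction b) auto
  show ?thesis
    by (rule recursive_cong[OF recursive_rec_nat[where f = f and g = "\<lambda>_ y _. y - 1"
          and a = g and k = k]])
      (use eq assms in \<open>auto intro!: pred[unfolded One_nat_def] rec_intros\<close>)
qed

lemma recursive_power [rec_intros]:
  assumes "recursive k f" "recursive k g"
  shows "recursive k (\<lambda>xs. f xs ^ g xs)"
proof -
  have eq: "rec_nat 1 (\<lambda>_ y. y * a) b = a ^ b" for a b :: nat by (induction b) auto
  show ?thesis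
    by (rule recursive_cong[OF recursive_rec_nat[where f = "\<lambda>_. 1" and g = "\<lambda>_ y xs. y * f xs"
          and a = g and k = k]])
      (use eq assms in \<open>auto intro!: rec_intros recursive_tl\<close>)
qed

lemma recursive_triangle [rec_intros]:
  assumes "recursive k f"
  shows "recursive k (\<lambda>xs. triangle (f xs))"
proof -
  have eq: "rec_nat 0 (\<lambda>n y. y + Suc n) b = triangle b" for b :: nat by (induction b) auto
  show ?thesis
    by (rule recursive_cong[OF recursive_rec_nat[where f = "\<lambda>_. 0" and g = "\<lambda>n y _. y + Suc n"
          and a = f and k = k]])
      (use eq assms in \<open>auto intro!: rec_intros simp del: add_Suc_right\<close>)
qed

lemma recursive_of_bool [rec_intros]: "decidable k P \<Longrightarrow> recursive k (\<lambda>xs. of_bool (P xs))"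
  by (simp add: decidable_def)

lemma decidable_less [rec_intros]:
  assumes "recursive k f" "recursive k g"
  shows "decidable k (\<lambda>xs. f xs < g xs)"
  unfolding decidable_def
  by (rule recursive_cong[where F = "\<lambda>xs. 1 - (Suc (f xs) - g xs)"]) (auto intro!: rec_intros assms)

lemma decidable_not [rec_intros]:
  assumes "decidable k P"
  shows "decidable k (\<lambda>xs. \<not> P xs)"
  unfolding decidable_def
  by (rule recursive_cong[where F = "\<lambda>xs. 1 - of_bool (P xs)"]) (auto intro!: rec_intros assms)

lemma decidable_conj [rec_intros]:
  assumes "decidable k P" "decidable k Q"
  shows "decidable k (\<lambda>xs. P xs \<and> Q xs)"
  unfolding decidable_def
  by (rule recursive_cong[where F = "\<lambda>xs. of_bool (P xs) * of_bool (Q xs)"])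
    (auto intro!: rec_intros assms)

lemma decidable_disj [rec_intros]:
  assumes "decidable k P" "decidable k Q"
  shows "decidable k (\<lambda>xs. P xs \<or> Q xs)"
  using decidable_not[OF decidable_conj[OF decidable_not decidable_not]] assms by force

lemma decidable_le [rec_intros]:
  assumes "recursive k f" "recursive k g"
  shows "decidable k (\<lambda>xs. f xs \<le> g xs)"
  using decidable_not[OF decidable_less[OF assms(2,1)]] by (simp add: not_less)

lemma decidable_eq [rec_intros]:
  assumes "recursive k f" "recursive k g"
  shows "decidable k (\<lambda>xs. f xs = g xs)"
  using decidable_conj[OF decidable_le[OF assms] decidable_le[OF assms(2,1)]]
  by (simp add: order_antisym_conv eq_iff)

lemma recursive_If [rec_intros]:
  assumes "decidable k P" "recursive k f" "recursive k g"
  shows "recursive k (\<lambda>xs. if P xs then f xs else g xs)"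
  by (rule recursive_cong[where F = "\<lambda>xs. of_bool (P xs) * f xs + (1 - of_bool (P xs)) * g xs"])
    (auto intro!: rec_intros assms)

lemma recursive_Least [rec_intros]:
  assumes "decidable (Suc k) (\<lambda>ys. P (ys ! 0) (tl ys))"
    and "\<And>xs. length xs = k \<Longrightarrow> \<exists>n. P n xs"
  shows "recursive k (\<lambda>xs. LEAST n. P n xs)"
proof -
  \<comment> \<open>\<open>Mu\<close> looks for a zero, hence the negation; before the least
    solution the value is \<open>Suc 0\<close>, as the side condition of \<open>Mu\<close>
    demands.\<close>
  obtain e where e: "\<And>ys. length ys = Suc k \<Longrightarrow> computes e ys (of_bool (\<not> P (ys ! 0) (tl ys)))"
    using decidable_not[OF assms(1)] unfolding decidable_def recursive_def by metis
  have "computes (Mu e) xs (LEAST n. P n xs)" if "length xs = k" for xs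
  proof (rule Mu)
    show "computes e ((LEAST n. P n xs) # xs) 0"
      using e[of "(LEAST n. P n xs) # xs"] that LeastI_ex[OF assms(2)] by auto
    show "\<forall>m<(LEAST n. P n xs). \<exists>y. computes e (m # xs) (Suc y)"
    proof (intro allI impI)
      fix m assume "m < (LEAST n. P n xs)"
      then show "\<exists>y. computes e (m # xs) (Suc y)"
        using e[of "m # xs"] that not_less_Least[of m "\<lambda>n. P n xs"]
        by (auto intro: exI[where x = 0])
    qed
  qed
  then show ?thesis unfolding recursive_def by blast
qed

lemma triangle_mono: "m \<le> n \<Longrightarrow> triangle m \<le> triangle n"
  by (induction n) (auto simp: le_Suc_eq)

text \<open>The code is \<open>triangle (m + n) + m\<close> and lies below
  \<open>triangle (Suc (m + n))\<close>, so a search for the next triangular number recovers the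
  diagonal \<open>m + n\<close>. Both components then follow by subtraction.\<close>

lemma Least_triangle: "(LEAST w. prod_encode (m, n) < triangle (Suc w)) = m + n"
proof (rule Least_equality)
  show "m + n \<le> w" if "prod_encode (m, n) < triangle (Suc w)" for w
    using triangle_mono[of "Suc w" "m + n"] that by (force simp: prod_encode_def)
qed (simp add: prod_encode_def)

lemma recursive_prod_encode [rec_intros]:
  assumes "recursive k f" "recursive k g"
  shows "recursive k (\<lambda>xs. prod_encode (f xs, g xs))"
  unfolding prod_encode_def using assms by (auto intro!: rec_intros)

lemma recursive_fst_add_snd_prod_decode:
  assumes "recursive k f"
  shows "recursive k (\<lambda>xs. fst (prod_decode (f xs)) + snd (prod_decode (f xs)))"
proof (rule recursive_cong)
  show "recursive k (\<lambda>xs. LEAST w. f xs < triangle (Suc w))"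
  proof (intro rec_intros)
    show "recursive (Suc k) (\<lambda>ys. f (tl ys))" by (rule recursive_tl[OF assms])
    show "\<exists>n. f xs < triangle (Suc n)" for xs
      by (rule exI[of _ "f xs"]) (simp add: less_Suc_eq_le)
  qed simp
  show "(LEAST w. f xs < triangle (Suc w)) =
    fst (prod_decode (f xs)) + snd (prod_decode (f xs))" for xs
    using Least_triangle[of "fst (prod_decode (f xs))" "snd (prod_decode (f xs))"] by simp
qed

lemma recursive_fst_prod_decode [rec_intros]:
  assumes "recursive k f"
  shows "recursive k (\<lambda>xs. fst (prod_decode (f xs)))"
proof (rule recursive_cong)
  show "recursive k (\<lambda>xs. f xs - triangle (fst (prod_decode (f xs)) + snd (prod_decode (f xs))))"
    by (intro recursive_diff recursive_triangle recursive_fst_add_snd_prod_decode assms)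
  show "f xs - triangle (fst (prod_decode (f xs)) + snd (prod_decode (f xs))) =
    fst (prod_decode (f xs))" for xs
    using prod_decode_inverse[of "f xs"]
    by (cases "prod_decode (f xs)") (auto simp: prod_encode_def)
qed

lemma recursive_snd_prod_decode [rec_intros]:
  assumes "recursive k f"
  shows "recursive k (\<lambda>xs. snd (prod_decode (f xs)))"
  using recursive_diff[OF recursive_fst_add_snd_prod_decode[OF assms]
      recursive_fst_prod_decode[OF assms]]
  by simp

lemma recursive_div [rec_intros]:
  assumes "recursive k f" "recursive k g"
  shows "recursive k (\<lambda>xs. f xs div g xs)"
proof (rule recursive_cong)
  \<comment> \<open>The disjunct \<open>g xs = 0\<close> makes the search total and yields 0, the
    value of division by zero.\<close>
  show "recursive k (\<lambda>xs. LEAST q. g xs = 0 \<or> f xs < Suc q * g xs)"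
  proof (intro rec_intros)
    show "\<exists>q. g xs = 0 \<or> f xs < Suc q * g xs" for xs
      by (intro exI[of _ "f xs"]) (cases "g xs", auto)
  qed (use assms recursive_tl in auto)
  show "(LEAST q. g xs = 0 \<or> f xs < Suc q * g xs) = f xs div g xs" for xs
    by (cases "g xs = 0", simp)
      (intro Least_equality, auto simp: dividend_less_times_div less_mult_imp_div_less
        simp flip: less_Suc_eq_le simp del: mult_Suc, simp add: dividend_less_div_times add.commute)
qed

lemma decidable_odd [rec_intros]:
  assumes "recursive k f"
  shows "decidable k (\<lambda>xs. odd (f xs))"
  unfolding decidable_def
proof (rule recursive_cong)
  show "recursive k (\<lambda>xs. f xs - 2 * (f xs div 2))" using assms by (intro rec_intros)
  show "f xs - 2 * (f xs div 2) = of_bool (odd (f xs))" for xs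
    by (simp add: minus_mult_div_eq_mod mod_2_eq_odd)
qed

lemma decidable_set_decode [rec_intros]:
  assumes "recursive k f" "recursive k g"
  shows "decidable k (\<lambda>xs. f xs \<in> set_decode (g xs))"
  unfolding set_decode_def mem_Collect_eq by (intro rec_intros assms)

section \<open>Evaluation in stages\<close>

lemma decidable_const [rec_intros]: "decidable k (\<lambda>xs. b)"
  unfolding decidable_def by (rule recursive_const)

lemma decidable_list_ex:
  "(\<And>g. g \<in> set gs \<Longrightarrow> decidable k (P g)) \<Longrightarrow> decidable k (\<lambda>xs. \<exists>g\<in>set gs. P g xs)"
  by (induction gs) (auto intro: rec_intros)

inductive_simps computes_Zero_iff: "computes Zero xs y"
inductive_simps computes_Succ_iff: "computes Succ xs y"
inductive_simps computes_Proj_iff: "computes (Proj i) xs y"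
inductive_simps computes_Comp_iff: "computes (Comp f gs) xs y"
inductive_simps computes_PRec_iff: "computes (PRec f g) xs y"
inductive_simps computes_Mu_iff: "computes (Mu f) xs y"

text \<open>\<open>E t xs\<close> is \<open>0\<close> as long as the computation has not terminated within the budget \<open>t\<close>,
  and the successor of its value from then on.\<close>

definition stages :: "recf \<Rightarrow> nat \<Rightarrow> (nat \<Rightarrow> nat list \<Rightarrow> nat) \<Rightarrow> bool" where
  "stages f k E \<longleftrightarrow> recursive (Suc k) (\<lambda>ys. E (ys ! 0) (tl ys)) \<and>
     (\<forall>xs. length xs = k \<longrightarrow> (\<forall>t t' y. t \<le> t' \<longrightarrow> E t xs = Suc y \<longrightarrow> E t' xs = Suc y) \<and>
       (\<forall>y. computes f xs y \<longleftrightarrow> (\<exists>t. E t xs = Suc y)))"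

lemma stages_eventually:
  assumes "stages f k E" "length xs = k" "computes f xs y"
  shows "\<forall>\<^sub>F t in sequentially. E t xs = Suc y"
  using assms unfolding stages_def eventually_sequentially by blast

lemma stagesI:
  assumes "recursive (Suc k) (\<lambda>ys. E (ys ! 0) (tl ys))"
    and "\<And>xs t t' y. length xs = k \<Longrightarrow> t \<le> t' \<Longrightarrow> E t xs = Suc y \<Longrightarrow> E t' xs = Suc y"
    and "\<And>xs t y. length xs = k \<Longrightarrow> E t xs = Suc y \<Longrightarrow> computes f xs y"
    and "\<And>xs y. length xs = k \<Longrightarrow> computes f xs y \<Longrightarrow> \<forall>\<^sub>F t in sequentially. E t xs = Suc y"
  shows "stages f k E"
  unfolding stages_def
proof (intro conjI allI impI)
  show "computes f xs y \<longleftrightarrow> (\<exists>t. E t xs = Suc y)" if "length xs = k" for xs y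
    using assms(3)[OF that] eventually_happens'[OF sequentially_bot assms(4)[OF that]] by blast
qed (use assms in blast)+

lemma stages_mono:
  "stages f k E \<Longrightarrow> length xs = k \<Longrightarrow> t \<le> t' \<Longrightarrow> E t xs = Suc y \<Longrightarrow> E t' xs = Suc y"
  unfolding stages_def by blast

lemma stages_sound: "stages f k E \<Longrightarrow> length xs = k \<Longrightarrow> E t xs = Suc y \<Longrightarrow> computes f xs y"
  unfolding stages_def by blast

lemma stages_recursive: "stages f k E \<Longrightarrow> recursive (Suc k) (\<lambda>ys. E (ys ! 0) (tl ys))"
  unfolding stages_def by blast

text \<open>The outer term is consulted only once all arguments have terminated; their stages no
  longer change then, and \<open>- 1\<close> removes the shift from stage to value.\<close>

lemma stages_Comp:
  assumes f: "stages f (length gs) Ef" and g: "\<And>g. g \<in> set gs \<Longrightarrow> stages g k (Eg g)"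
  shows "stages (Comp f gs) k
    (\<lambda>t xs. if \<exists>g\<in>set gs. Eg g t xs = 0 then 0 else Ef t (map (\<lambda>g. Eg g t xs - 1) gs))"
    (is "stages _ _ ?E")
proof (rule stagesI)
  have "recursive (Suc k) (\<lambda>ys. Ef (ys ! 0) (map (\<lambda>g. Eg g (ys ! 0) (tl ys) - 1) gs))"
  proof -
    let ?Gs = "(\<lambda>ys. ys ! 0) # map (\<lambda>g ys. Eg g (ys ! 0) (tl ys) - 1) gs"
    have "recursive (Suc k) (\<lambda>xs. (\<lambda>ys. Ef (ys ! 0) (tl ys)) (map (\<lambda>G. G xs) ?Gs))"
      using stages_recursive[OF f] stages_recursive[OF g]
      by (intro recursive_subst) (auto intro: recursive_proj recursive_diff recursive_const)
    then show ?thesis by (simp add: comp_def)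
  qed
  then show "recursive (Suc k) (\<lambda>ys. ?E (ys ! 0) (tl ys))"
    by (intro recursive_If decidable_list_ex decidable_eq recursive_const stages_recursive[OF g])
next
  fix xs t t' y
  assume xs: "length xs = k" and t: "t \<le> t'" and E: "?E t xs = Suc y"
  then have "\<exists>v. Eg g t xs = Suc v" if "g \<in> set gs" for g
    using that by (auto split: if_splits simp: not0_implies_Suc)
  then have eq: "Eg g t' xs = Eg g t xs \<and> Eg g t xs \<noteq> 0" if "g \<in> set gs" for g
    using stages_mono[OF g[OF that] xs t] that by fastforce
  then have "map (\<lambda>g. Eg g t' xs - 1) gs = map (\<lambda>g. Eg g t xs - 1) gs" by simp
  moreover have "Ef t' (map (\<lambda>g. Eg g t xs - 1) gs) = Suc y"
    using stages_mono[OF f _ t] E by (auto split: if_splits)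
  moreover have "\<not> (\<exists>g\<in>set gs. Eg g t' xs = 0)" using eq by metis
  then have "?E t' xs = Ef t' (map (\<lambda>g. Eg g t' xs - 1) gs)" by (rule if_not_P)
  ultimately show "?E t' xs = Suc y" by metis
next
  fix xs t y
  assume xs: "length xs = k" and E: "?E t xs = Suc y"
  then have "Eg g t xs \<noteq> 0" if "g \<in> set gs" for g
    using that by (auto split: if_splits)
  then have "computes g xs (Eg g t xs - 1)" if "g \<in> set gs" for g
    using stages_sound[OF g xs, of g t "Eg g t xs - 1"] that by auto
  then have "list_all2 (\<lambda>g y. computes g xs y) gs (map (\<lambda>g. Eg g t xs - 1) gs)"
    by (auto simp: list_all2_conv_all_nth)
  moreover have "computes f (map (\<lambda>g. Eg g t xs - 1) gs) y"
    using stages_sound[OF f, of _ t] E by (auto split: if_splits)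
  ultimately show "computes (Comp f gs) xs y" by (rule Comp)
next
  fix xs y
  assume xs: "length xs = k" and "computes (Comp f gs) xs y"
  then obtain ys where ys: "list_all2 (\<lambda>g y. computes g xs y) gs ys" "computes f ys y"
    by (auto simp: computes_Comp_iff)
  have "\<forall>\<^sub>F t in sequentially. \<forall>i\<in>{..<length gs}. Eg (gs ! i) t xs = Suc (ys ! i)"
    using ys(1) by (intro eventually_ball_finite ballI stages_eventually[OF g xs])
      (auto simp: list_all2_conv_all_nth)
  moreover have "\<forall>\<^sub>F t in sequentially. Ef t ys = Suc y"
    using ys by (intro stages_eventually[OF f]) (auto dest: list_all2_lengthD)
  ultimately show "\<forall>\<^sub>F t in sequentially. ?E t xs = Suc y"
  proof eventually_elim
    case (elim t)
    moreover have "map (\<lambda>g. Eg g t xs - 1) gs = ys"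
      using elim ys(1) by (auto intro!: nth_equalityI simp: list_all2_conv_all_nth)
    moreover have "Eg g t xs \<noteq> 0" if "g \<in> set gs" for g
      using elim(1) that by (auto simp: in_set_conv_nth)
    ultimately show ?case by auto
  qed
qed

text \<open>The recursion runs on stages instead of values: 0, for "not yet terminated", is passed
  on unchanged, and any other stage is unshifted before it enters \<open>Eg\<close>.\<close>

lemma stages_PRec:
  assumes f: "stages f k Ef" and g: "stages g (Suc (Suc k)) Eg"
  shows "stages (PRec f g) (Suc k) (\<lambda>t xs. rec_nat (Ef t (tl xs))
    (\<lambda>n y. if y = 0 then 0 else Eg t (n # (y - 1) # tl xs)) (xs ! 0))"
    (is "stages _ _ ?E")
proof (rule stagesI)
  have "recursive (Suc (Suc k)) (\<lambda>ys. Ef (ys ! 0) (tl (tl ys)))"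
    using recursive_Cons_tl_tl[OF stages_recursive[OF f]] by simp
  moreover have "recursive (Suc (Suc (Suc (Suc k))))
    (\<lambda>ys. Eg (tl (tl ys) ! 0) (ys ! 0 # (ys ! 1 - 1) # tl (tl (tl (tl ys)))))"
  proof (rule recursive_cong)
    \<comment> \<open>The list holds counter, previous stage, budget, recursion bound, parameters.
      Entry 3, the bound, is dropped, and the parameters start at entry 4.\<close>
    let ?Gs = "(\<lambda>ys. ys ! 2) # (\<lambda>ys. ys ! 0) # (\<lambda>ys. ys ! 1 - 1) # map (\<lambda>i ys. ys ! i) [4..<k + 4]"
    show "recursive (Suc (Suc (Suc (Suc k))))
      (\<lambda>xs. (\<lambda>ys. Eg (ys ! 0) (tl ys)) (map (\<lambda>G. G xs) ?Gs))"
      using stages_recursive[OF g] by (intro recursive_subst) (auto intro!: rec_intros)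
    show "(\<lambda>ys. Eg (ys ! 0) (tl ys)) (map (\<lambda>G. G xs) ?Gs) =
      Eg (tl (tl xs) ! 0) (xs ! 0 # (xs ! 1 - 1) # tl (tl (tl (tl xs))))"
      if "length xs = Suc (Suc (Suc (Suc k)))" for xs
    proof -
      have "map ((!) xs) [4..<k + 4] = tl (tl (tl (tl xs)))"
        using map_nth_upt_length[of xs 4] that by (simp add: drop_Suc eval_nat_numeral del: upt_Suc)
      with that show ?thesis by (simp add: comp_def nth_tl numeral_2_eq_2)
    qed
  qed
  ultimately show "recursive (Suc (Suc k)) (\<lambda>ys. ?E (ys ! 0) (tl ys))"
    by (intro recursive_rec_nat recursive_If decidable_eq recursive_const recursive_proj
        recursive_proj_tl)
      simp_all
next
  fix xs t t' y
  assume xs: "length xs = Suc k" and t: "t \<le> t'" and E: "?E t xs = Suc y"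
  then obtain n zs where [simp]: "xs = n # zs" "length zs = k" by (auto simp: length_Suc_conv)
  from E show "?E t' xs = Suc y"
    by simp (induction n arbitrary: y;
      auto split: if_splits simp: gr0_conv_Suc intro: stages_mono[OF f _ t] stages_mono[OF g _ t])
next
  fix xs t y
  assume xs: "length xs = Suc k" and E: "?E t xs = Suc y"
  then obtain n zs where xs_eq: "xs = n # zs" and [simp]: "length zs = k"
    by (auto simp: length_Suc_conv)
  from E have "?E t (n # zs) = Suc y" unfolding xs_eq .
  then have "computes (PRec f g) (n # zs) y"
  proof (induction n arbitrary: y)
    case 0
    then show ?case by (auto intro: PRec_0 stages_sound[OF f \<open>length zs = k\<close>])
  next
    case (Suc n)
    then obtain v where "?E t (n # zs) = Suc v" "Eg t (n # v # zs) = Suc y"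
      by (auto split: if_splits simp: gr0_conv_Suc cong: if_cong)
    then show ?case using Suc.IH stages_sound[OF g, of "n # v # zs"] by (intro PRec_Suc) auto
  qed
  then show "computes (PRec f g) xs y" by (simp add: xs_eq)
next
  fix xs y
  assume xs: "length xs = Suc k" and "computes (PRec f g) xs y"
  moreover from xs obtain n zs where xs_eq: "xs = n # zs" and [simp]: "length zs = k"
    by (auto simp: length_Suc_conv)
  ultimately have "computes (PRec f g) (n # zs) y" by simp
  then have "\<forall>\<^sub>F t in sequentially. ?E t (n # zs) = Suc y"
  proof (induction n arbitrary: y)
    case 0
    then have "computes f zs y" by (subst (asm) computes_PRec_iff) auto
    then show ?case using stages_eventually[OF f] by simp
  next
    case (Suc n)
    then obtain v where v: "computes (PRec f g) (n # zs) v" "computes g (n # v # zs) y"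
      by (subst (asm) computes_PRec_iff) auto
    from Suc.IH[OF v(1)] stages_eventually[OF g _ v(2), simplified] show ?case
      by eventually_elim (simp cong: if_cong)
  qed
  then show "\<forall>\<^sub>F t in sequentially. ?E t xs = Suc y" unfolding xs_eq .
qed

text \<open>The search stops at the first \<open>n\<close> whose stage is 0 (undecided) or 1 (value
  0), and at \<open>t\<close> at the latest, which makes it total. Only a stop below
  \<open>t\<close> at stage 1 counts as success; a stop at an undecided argument must not be
  skipped, since \<open>Mu\<close> requires all earlier values to be defined.\<close>

lemma stages_Mu:
  assumes f: "stages f (Suc k) Ef"
  shows "stages (Mu f) k (\<lambda>t xs. if (LEAST n. n = t \<or> Ef t (n # xs) \<le> 1) < t \<and>
     Ef t ((LEAST n. n = t \<or> Ef t (n # xs) \<le> 1) # xs) = 1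
     then Suc (LEAST n. n = t \<or> Ef t (n # xs) \<le> 1) else 0)"
    (is "stages _ _ ?E")
proof -
  define L where "L t xs = (LEAST n. n = t \<or> Ef t (n # xs) \<le> 1)" for t xs
  have L: "1 < Ef t (m # xs)" if "m < L t xs" for t xs m
    using not_less_Least[OF that[unfolded L_def]] by simp
  have "L t xs = n" if "n < t" "Ef t (n # xs) = 1" "\<forall>m<n. 1 < Ef t (m # xs)" for t xs n
    unfolding L_def
  proof (rule Least_equality)
    show "n \<le> m" if "m = t \<or> Ef t (m # xs) \<le> 1" for m
      using that \<open>n < t\<close> \<open>\<forall>m<n. 1 < Ef t (m # xs)\<close> by (meson leD leI less_imp_le)
  qed (use that in simp)
  \<comment> \<open>A stage above 1 is a positive value already found, so the right-hand side is the
    rule \<open>Mu\<close> witnessed within budget \<open>t\<close>. Each of its conditions persists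
    when the budget grows.\<close>
  then have E: "?E t xs = Suc n \<longleftrightarrow> n < t \<and> Ef t (n # xs) = 1 \<and> (\<forall>m<n. 1 < Ef t (m # xs))"
    for t xs n
    unfolding L_def[symmetric] using L by (metis Suc_inject nat.distinct(1))
  show ?thesis
  proof (rule stagesI)
    have "recursive (Suc (Suc k)) (\<lambda>ys. Ef (tl ys ! 0) (ys ! 0 # tl (tl ys)))"
    proof (rule recursive_cong)
      \<comment> \<open>The search variable comes before the budget in the list, whereas
        \<open>Ef\<close> expects the budget first.\<close>
      let ?js = "1 # 0 # [2..<k + 2]"
      show "recursive (Suc (Suc k)) (\<lambda>xs. (\<lambda>ys. Ef (ys ! 0) (tl ys)) (map ((!) xs) ?js))"
        using stages_recursive[OF f]
        by (intro recursive_reindex) (auto simp: numeral_2_eq_2 simp del: upt_Suc)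
      show "(\<lambda>ys. Ef (ys ! 0) (tl ys)) (map ((!) xs) ?js) = Ef (tl xs ! 0) (xs ! 0 # tl (tl xs))"
        if "length xs = Suc (Suc k)" for xs
      proof -
        have "map ((!) xs) [2..<k + 2] = tl (tl xs)"
          using map_nth_upt_length[of xs 2] that
          by (simp add: drop_Suc eval_nat_numeral del: upt_Suc)
        with that show ?thesis by (simp add: nth_tl)
      qed
    qed
    note Ef_rec = this
    have L_rec: "recursive (Suc k) (\<lambda>ys. L (ys ! 0) (tl ys))"
      unfolding L_def
      by (intro recursive_Least decidable_disj decidable_eq decidable_le Ef_rec recursive_proj
          recursive_proj_tl recursive_const) auto
    show "recursive (Suc k) (\<lambda>ys. ?E (ys ! 0) (tl ys))"
      unfolding L_def[symmetric]
      using recursive_subst_Cons[OF Ef_rec L_rec]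
      by (intro recursive_If decidable_conj decidable_eq decidable_less L_rec recursive_proj
          recursive_Suc recursive_const) auto
  next
    show "?E t' xs = Suc y" if "length xs = k" "t \<le> t'" "?E t xs = Suc y" for xs t t' y
    proof -
      have "Ef t' (m # xs) = Ef t (m # xs)" if "Ef t (m # xs) > 0" for m
        using that stages_mono[OF f _ \<open>t \<le> t'\<close>, of "m # xs"] \<open>length xs = k\<close>
        by (auto simp: gr0_conv_Suc)
      then show ?thesis using that unfolding E by auto
    qed
  next
    show "computes (Mu f) xs y" if "length xs = k" "?E t xs = Suc y" for xs t y
    proof (rule Mu)
      show "computes f (y # xs) 0" using that stages_sound[OF f, of "y # xs" t] unfolding E by auto
      show "\<forall>m<y. \<exists>v. computes f (m # xs) (Suc v)"
        using that stages_sound[OF f, of "_ # xs" t] unfolding E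
        by (metis Suc_length_conv One_nat_def less_natE add_Suc_shift plus_1_eq_Suc)
    qed
  next
    fix xs y
    assume xs: "length xs = k" and "computes (Mu f) xs y"
    then obtain v where v: "computes f (y # xs) 0" "\<forall>m<y. computes f (m # xs) (Suc (v m))"
      by (subst (asm) computes_Mu_iff) metis
    have "\<forall>\<^sub>F t in sequentially. \<forall>m\<in>{..<y}. Ef t (m # xs) = Suc (Suc (v m))"
      using xs v(2) by (intro eventually_ball_finite ballI stages_eventually[OF f]) auto
    moreover have "\<forall>\<^sub>F t in sequentially. Ef t (y # xs) = Suc 0"
      using xs v(1) by (intro stages_eventually[OF f]) auto
    ultimately show "\<forall>\<^sub>F t in sequentially. ?E t xs = Suc y"
      using eventually_gt_at_top[of y]
      unfolding E by eventually_elim auto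
  qed
qed

text \<open>The arity is generalized because terms carry none: the parts of a compound term are
  evaluated at other arities.\<close>

lemma stages_exist: "\<exists>E. stages f k E"
proof (induction f arbitrary: k)
  case Zero
  have "stages Zero k (\<lambda>_ _. 1)" by (rule stagesI) (auto simp: computes_Zero_iff intro: rec_intros)
  then show ?case by blast
next
  case Succ
  \<comment> \<open>One \<open>Suc\<close> is the function, the other the shift of stages; at any
    other arity no rule applies and the stage stays 0.\<close>
  have "stages Succ k (\<lambda>_ xs. if k = 1 then Suc (Suc (xs ! 0)) else 0)"
    
  proof (rule stagesI)
    show "recursive (Suc k) (\<lambda>ys. if k = 1 then Suc (Suc (tl ys ! 0)) else 0)"
      by (cases "k = 1"; simp; intro rec_intros; simp)
  qed (auto simp: computes_Succ_iff length_Suc_conv split: if_splits)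
  then show ?case by blast
next
  case (Proj i)
  have "stages (Proj i) k (\<lambda>_ xs. if i < k then Suc (xs ! i) else 0)"
    by (rule stagesI)
      (cases "i < k"; auto simp: computes_Proj_iff intro: rec_intros split: if_splits)+
  then show ?case by blast
next
  case (Comp f gs)
  then have "\<forall>g. \<exists>E. g \<in> set gs \<longrightarrow> stages g k E" by blast
  then obtain Eg where "\<And>g. g \<in> set gs \<Longrightarrow> stages g k (Eg g)" by metis
  then show ?case using Comp.IH(1)[of "length gs"] stages_Comp by blast
next
  case (PRec f g)
  show ?case
  proof (cases k)
    case 0
    have "stages (PRec f g) 0 (\<lambda>_ _. 0)"
      by (rule stagesI) (auto simp: computes_PRec_iff[of _ _ "[]"] intro: recursive_const)
    then show ?thesis using 0 by blast
  next
    case (Suc k')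
    obtain Ef Eg where "stages f k' Ef" "stages g (Suc (Suc k')) Eg" using PRec by blast
    from stages_PRec[OF this] show ?thesis using Suc by blast
  qed
next
  case (Mu f)
  then show ?case using stages_Mu by blast
qed

section \<open>C.e. sets as projections, enumerations by stages, enumeration reductions\<close>

lemma ce_projection:
  assumes "\<And>k f g. recursive k f \<Longrightarrow> recursive k g \<Longrightarrow> decidable k (\<lambda>xs. P (f xs) (g xs))"
  shows "ce {x. \<exists>t. P t x}"
proof -
  have "recursive 2 (\<lambda>xs. of_bool (\<not> P (xs ! 0) (xs ! 1)))"
    by (intro rec_intros assms) simp_all
  then obtain e where "\<And>xs. length xs = 2 \<Longrightarrow> computes e xs (of_bool (\<not> P (xs ! 0) (xs ! 1)))"
    unfolding recursive_def by blast
  from this[of "[_, _]"] have e: "computes e [t, x] (of_bool (\<not> P t x))" for t x by simp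
  have "(\<exists>y. computes (Mu e) [x] y) \<longleftrightarrow> (\<exists>t. P t x)" for x
  proof
    assume "\<exists>y. computes (Mu e) [x] y"
    then obtain t where "computes e [t, x] 0" by (auto simp: computes_Mu_iff)
    \<comment> \<open>Determinism identifies the zero found by the search with the known value of
      \<open>e\<close>.\<close>
    then have "of_bool (\<not> P t x) = (0 :: nat)" using e computes_deterministic by blast
    then show "\<exists>t. P t x" by (auto split: if_splits)
  next
    assume P: "\<exists>t. P t x"
    have "computes (Mu e) [x] (LEAST t. P t x)"
    proof (intro Mu allI impI)
      show "computes e ((LEAST t. P t x) # [x]) 0"
        using e[of "LEAST t. P t x" x] LeastI_ex[OF P] by simp
      show "\<exists>y. computes e (m # [x]) (Suc y)" if "m < (LEAST t. P t x)" for m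
        using e[of m x] not_less_Least[OF that] by (intro exI[of _ 0]) simp
    qed
    then show "\<exists>y. computes (Mu e) [x] y" ..
  qed
  then show ?thesis unfolding ce_def by blast
qed

text \<open>Both witnesses are packed into one by pairing. The hypothesis ranges over all
  substitution instances of \<open>P\<close>, so that closure rules discharge it directly.\<close>

lemma ce_projection2:
  assumes "\<And>k f g h. recursive k f \<Longrightarrow> recursive k g \<Longrightarrow> recursive k h \<Longrightarrow>
    decidable k (\<lambda>xs. P (f xs) (g xs) (h xs))"
  shows "ce {x. \<exists>t d. P t d x}"
proof -
  have "ce {x. \<exists>w. P (fst (prod_decode w)) (snd (prod_decode w)) x}"
    by (intro ce_projection assms rec_intros)
  moreover have "(\<exists>w. P (fst (prod_decode w)) (snd (prod_decode w)) x) \<longleftrightarrow> (\<exists>t d. P t d x)" for x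
    by (metis fst_conv snd_conv prod_encode_inverse)
  ultimately show ?thesis by simp
qed

text \<open>Membership becomes the existence of a stage at which a decidable test succeeds. The last
  property lets finitely many memberships be confirmed at one common stage.\<close>

lemma uniformly_ce_enumeration:
  assumes "uniformly_ce A"
  obtains en where
    "\<And>k t n x. recursive k t \<Longrightarrow> recursive k n \<Longrightarrow> recursive k x \<Longrightarrow>
      decidable k (\<lambda>xs. en (t xs) (n xs) (x xs))"
    "\<And>n x. (\<exists>t. en t n x) \<longleftrightarrow> x \<in> A n"
    "\<And>n x. x \<in> A n \<Longrightarrow> \<forall>\<^sub>F t in sequentially. en t n x"
proof -
  obtain f where f: "\<And>n. A n = {x. \<exists>y. computes f [n, x] y}"
    using assms unfolding uniformly_ce_def by blast
  obtain E where E: "stages f 2 E" using stages_exist by blast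
  show thesis
  proof (rule that[of "\<lambda>t n x. E t [n, x] \<noteq> 0"])
    fix k t n x
    assume "recursive k t" "recursive k n" "recursive k x"
    moreover from stages_recursive[OF E]
    have "recursive (length [t, n, x]) (\<lambda>ys. E (ys ! 0) (tl ys))"
      by (simp add: numeral_2_eq_2)
    ultimately have "recursive k (\<lambda>xs. (\<lambda>ys. E (ys ! 0) (tl ys)) (map (\<lambda>G. G xs) [t, n, x]))"
      by (intro recursive_subst) auto
    then show "decidable k (\<lambda>xs. E (t xs) [n xs, x xs] \<noteq> 0)"
      by (intro rec_intros) simp
  next
    have "computes f [n, x] y \<longleftrightarrow> (\<exists>t. E t [n, x] = Suc y)" for n x y
      using E unfolding stages_def by simp
    then show "(\<exists>t. E t [n, x] \<noteq> 0) \<longleftrightarrow> x \<in> A n" for n x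
      unfolding f mem_Collect_eq using not0_implies_Suc[of "E _ [n, x]"] nat.distinct(1) by metis
  next
    show "\<forall>\<^sub>F t in sequentially. E t [n, x] \<noteq> 0" if "x \<in> A n" for n x
    proof -
      from that obtain y where "computes f [n, x] y" unfolding f by blast
      from stages_eventually[OF E _ this] show ?thesis by (auto elim: eventually_mono)
    qed
  qed
qed

lemma enum_reducible_finite_set:
  assumes "\<And>k f g. recursive k f \<Longrightarrow> recursive k g \<Longrightarrow> decidable k (\<lambda>xs. P (f xs) (g xs))"
  shows "enum_reducible {x. \<exists>D. finite D \<and> D \<subseteq> B \<and> P x (set_encode D)} B"
proof -
  \<comment> \<open>The dummy quantifier brings a decidable set into the form of a
    projection.\<close>
  have "ce {z. \<exists>t :: nat. P (fst (prod_decode z)) (snd (prod_decode z))}"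
    by (intro ce_projection assms rec_intros)
  then show ?thesis unfolding enum_reducible_def
    by (intro exI[of _ "{z. P (fst (prod_decode z)) (snd (prod_decode z))}"]) auto
qed

text \<open>Reductions that consult one oracle element: the axioms use singletons, recognized by
  \<open>set_encode {c} = 2 ^ c\<close>, and the search for \<open>t\<close> and \<open>d\<close> is
  absorbed into the c.e. set of axioms.\<close>

lemma enum_reducible_element:
  assumes "\<And>k f g h l. recursive k f \<Longrightarrow> recursive k g \<Longrightarrow> recursive k h \<Longrightarrow> recursive k l \<Longrightarrow>
    decidable k (\<lambda>xs. P (f xs) (g xs) (h xs) (l xs))"
  shows "enum_reducible {x. \<exists>c\<in>B. \<exists>t d. P t d c x} B"
proof -
  \<comment> \<open>Only two witnesses can be projected away, so \<open>w\<close> codes the pair of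
    \<open>c\<close> and \<open>t\<close>.\<close>
  define W where "W = {z. \<exists>w d. snd (prod_decode z) = 2 ^ fst (prod_decode w) \<and>
    P (snd (prod_decode w)) d (fst (prod_decode w)) (fst (prod_decode z))}"
  have "ce W" unfolding W_def by (intro ce_projection2 assms rec_intros)
  moreover have "(\<exists>D. finite D \<and> D \<subseteq> B \<and> prod_encode (x, set_encode D) \<in> W) \<longleftrightarrow>
    (\<exists>c\<in>B. \<exists>t d. P t d c x)" for x
  proof
    assume "\<exists>D. finite D \<and> D \<subseteq> B \<and> prod_encode (x, set_encode D) \<in> W"
    then obtain D w d where D: "finite D" "D \<subseteq> B" "set_encode D = 2 ^ fst (prod_decode w)"
      "P (snd (prod_decode w)) d (fst (prod_decode w)) x" unfolding W_def by auto
    have "set_encode D = set_encode {fst (prod_decode w)}" using D(3) by simp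
    then have "D = {fst (prod_decode w)}" using D(1) by (simp only: set_encode_eq finite.intros)
    with D show "\<exists>c\<in>B. \<exists>t d. P t d c x" by blast
  next
    assume "\<exists>c\<in>B. \<exists>t d. P t d c x"
    then obtain c t d where "c \<in> B" "P t d c x" by blast
    moreover from \<open>P t d c x\<close> have "prod_encode (x, set_encode {c}) \<in> W"
      unfolding W_def by (intro CollectI exI[of _ "prod_encode (c, t)"] exI[of _ d]) simp
    ultimately have "finite {c} \<and> {c} \<subseteq> B \<and> prod_encode (x, set_encode {c}) \<in> W" by blast
    then show "\<exists>D. finite D \<and> D \<subseteq> B \<and> prod_encode (x, set_encode D) \<in> W" ..
  qed
  ultimately show ?thesis unfolding enum_reducible_def by (intro exI[of _ W]) (simp only: simp_thms)
qed

section \<open>Computable rational-valued functions\<close>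

text \<open>Fractions with a difference of naturals above a positive natural, not necessarily
  reduced. The values are reals so that they can be compared with the noncomputable
  \<open>u n\<close> and \<open>s\<close>.\<close>

definition real_recursive :: "nat \<Rightarrow> (nat list \<Rightarrow> real) \<Rightarrow> bool" where
  "real_recursive k F \<longleftrightarrow> (\<exists>a b c. recursive k a \<and> recursive k b \<and> recursive k c \<and>
     (\<forall>xs. length xs = k \<longrightarrow> c xs > 0 \<and> F xs = (real (a xs) - real (b xs)) / real (c xs)))"

lemma real_recursiveI:
  assumes "recursive k a" "recursive k b" "recursive k c"
    and "\<And>xs. length xs = k \<Longrightarrow> c xs > 0 \<and> F xs = (real (a xs) - real (b xs)) / real (c xs)"
  shows "real_recursive k F"
  using assms unfolding real_recursive_def by blast

lemma real_recursiveE: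
  assumes "real_recursive k F"
  obtains a b c where "recursive k a" "recursive k b" "recursive k c"
    "\<And>xs. length xs = k \<Longrightarrow> c xs > 0"
    "\<And>xs. length xs = k \<Longrightarrow> F xs = (real (a xs) - real (b xs)) / real (c xs)"
  using assms unfolding real_recursive_def by blast

lemma real_recursive_cong:
  "real_recursive k F \<Longrightarrow> (\<And>xs. length xs = k \<Longrightarrow> F xs = G xs) \<Longrightarrow> real_recursive k G"
  unfolding real_recursive_def by metis

lemma real_recursive_of_nat [rec_intros]:
  assumes "recursive k f"
  shows "real_recursive k (\<lambda>xs. real (f xs))"
  by (rule real_recursiveI[where a = f and b = "\<lambda>_. 0" and c = "\<lambda>_. 1"])
    (auto intro: assms recursive_const)

lemma real_recursive_numeral [rec_intros]: "real_recursive k (\<lambda>xs. numeral n)"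
  using real_recursive_of_nat[OF recursive_const[of k "numeral n"]] by simp

lemma real_recursive_0 [rec_intros]: "real_recursive k (\<lambda>xs. 0)"
  using real_recursive_of_nat[OF recursive_const[of k 0]] by simp

lemma real_recursive_1 [rec_intros]: "real_recursive k (\<lambda>xs. 1)"
  using real_recursive_of_nat[OF recursive_const[of k 1]] by simp

lemma real_recursive_minus [rec_intros]:
  assumes "real_recursive k F"
  shows "real_recursive k (\<lambda>xs. - F xs)"
proof -
  obtain a b c where F: "recursive k a" "recursive k b" "recursive k c"
    "\<And>xs. length xs = k \<Longrightarrow> c xs > 0"
    "\<And>xs. length xs = k \<Longrightarrow> F xs = (real (a xs) - real (b xs)) / real (c xs)"
    using real_recursiveE[OF assms] by blast
  show ?thesis
    by (rule real_recursiveI[where a = b and b = a and c = c]) (use F in \<open>auto simp: field_simps\<close>)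
qed

lemma real_recursive_add [rec_intros]:
  assumes "real_recursive k F" "real_recursive k G"
  shows "real_recursive k (\<lambda>xs. F xs + G xs)"
proof -
  obtain a b c where F: "recursive k a" "recursive k b" "recursive k c"
    "\<And>xs. length xs = k \<Longrightarrow> c xs > 0"
    "\<And>xs. length xs = k \<Longrightarrow> F xs = (real (a xs) - real (b xs)) / real (c xs)"
    using real_recursiveE[OF assms(1)] by blast
  obtain a' b' c' where G: "recursive k a'" "recursive k b'" "recursive k c'"
    "\<And>xs. length xs = k \<Longrightarrow> c' xs > 0"
    "\<And>xs. length xs = k \<Longrightarrow> G xs = (real (a' xs) - real (b' xs)) / real (c' xs)"
    using real_recursiveE[OF assms(2)] by blast
  show ?thesis
  proof (rule real_recursiveI)
    show "recursive k (\<lambda>xs. a xs * c' xs + a' xs * c xs)" by (intro rec_intros F G)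
    show "recursive k (\<lambda>xs. b xs * c' xs + b' xs * c xs)" by (intro rec_intros F G)
    show "recursive k (\<lambda>xs. c xs * c' xs)" by (intro rec_intros F G)
  next
    fix xs :: "nat list"
    assume xs: "length xs = k"
    show "0 < c xs * c' xs \<and> F xs + G xs = (real (a xs * c' xs + a' xs * c xs) -
      real (b xs * c' xs + b' xs * c xs)) / real (c xs * c' xs)"
      using F(4)[OF xs] G(4)[OF xs] by (simp add: F(5)[OF xs] G(5)[OF xs] field_simps)
  qed
qed

lemma real_recursive_diff [rec_intros]:
  assumes "real_recursive k F" "real_recursive k G"
  shows "real_recursive k (\<lambda>xs. F xs - G xs)"
  using real_recursive_add[OF assms(1) real_recursive_minus[OF assms(2)]] by simp

lemma real_recursive_mult [rec_intros]:
  assumes "real_recursive k F" "real_recursive k G"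
  shows "real_recursive k (\<lambda>xs. F xs * G xs)"
proof -
  obtain a b c where F: "recursive k a" "recursive k b" "recursive k c"
    "\<And>xs. length xs = k \<Longrightarrow> c xs > 0"
    "\<And>xs. length xs = k \<Longrightarrow> F xs = (real (a xs) - real (b xs)) / real (c xs)"
    using real_recursiveE[OF assms(1)] by blast
  obtain a' b' c' where G: "recursive k a'" "recursive k b'" "recursive k c'"
    "\<And>xs. length xs = k \<Longrightarrow> c' xs > 0"
    "\<And>xs. length xs = k \<Longrightarrow> G xs = (real (a' xs) - real (b' xs)) / real (c' xs)"
    using real_recursiveE[OF assms(2)] by blast
  show ?thesis
  proof (rule real_recursiveI)
    show "recursive k (\<lambda>xs. a xs * a' xs + b xs * b' xs)" by (intro rec_intros F G)
    show "recursive k (\<lambda>xs. a xs * b' xs + b xs * a' xs)" by (intro rec_intros F G)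
    show "recursive k (\<lambda>xs. c xs * c' xs)" by (intro rec_intros F G)
  next
    fix xs :: "nat list"
    assume xs: "length xs = k"
    show "0 < c xs * c' xs \<and> F xs * G xs = (real (a xs * a' xs + b xs * b' xs) -
      real (a xs * b' xs + b xs * a' xs)) / real (c xs * c' xs)"
      using F(4)[OF xs] G(4)[OF xs] by (simp add: F(5)[OF xs] G(5)[OF xs] field_simps)
  qed
qed

lemma real_recursive_inverse [rec_intros]:
  assumes "real_recursive k F"
  shows "real_recursive k (\<lambda>xs. inverse (F xs))"
proof -
  obtain a b c where F: "recursive k a" "recursive k b" "recursive k c"
    "\<And>xs. length xs = k \<Longrightarrow> c xs > 0"
    "\<And>xs. length xs = k \<Longrightarrow> F xs = (real (a xs) - real (b xs)) / real (c xs)"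
    using real_recursiveE[OF assms] by blast
  show ?thesis
  proof (rule real_recursiveI)
    show "recursive k (\<lambda>xs. if b xs < a xs then c xs else 0)" by (intro rec_intros F)
    show "recursive k (\<lambda>xs. if a xs < b xs then c xs else 0)" by (intro rec_intros F)
    \<comment> \<open>With truncated subtraction the sum is the distance of \<open>a xs\<close> and
      \<open>b xs\<close>. For equal arguments the denominator 1 meets two zero numerators, which
      gives \<open>inverse 0 = 0\<close>.\<close>
    show "recursive k (\<lambda>xs. if a xs = b xs then 1 else (a xs - b xs) + (b xs - a xs))"
      by (intro rec_intros F)
  next
    fix xs :: "nat list"
    assume "length xs = k"
    note F(4,5)[OF this]
    then show "0 < (if a xs = b xs then 1 else (a xs - b xs) + (b xs - a xs)) \<and>
      inverse (F xs) = (real (if b xs < a xs then c xs else 0) -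
          real (if a xs < b xs then c xs else 0)) /
        real (if a xs = b xs then 1 else (a xs - b xs) + (b xs - a xs))"
      by (cases "a xs" "b xs" rule: linorder_cases) (auto simp: of_nat_diff minus_divide_right)
  qed
qed

lemma real_recursive_divide [rec_intros]:
  assumes "real_recursive k F" "real_recursive k G"
  shows "real_recursive k (\<lambda>xs. F xs / G xs)"
  using real_recursive_mult[OF assms(1) real_recursive_inverse[OF assms(2)]]
  by (simp add: divide_inverse)

lemma real_recursive_If [rec_intros]:
  assumes "decidable k P" "real_recursive k F" "real_recursive k G"
  shows "real_recursive k (\<lambda>xs. if P xs then F xs else G xs)"
proof (rule real_recursive_cong)
  show "real_recursive k (\<lambda>xs. real (of_bool (P xs)) * F xs + (1 - real (of_bool (P xs))) * G xs)"
    by (intro rec_intros assms)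
qed simp

text \<open>Cross-multiplying and moving the subtracted parts to the other side leaves a comparison
  of naturals.\<close>

lemma decidable_real_less [rec_intros]:
  assumes "real_recursive k F" "real_recursive k G"
  shows "decidable k (\<lambda>xs. F xs < G xs)"
proof -
  obtain a b c where F: "recursive k a" "recursive k b" "recursive k c"
    "\<And>xs. length xs = k \<Longrightarrow> c xs > 0"
    "\<And>xs. length xs = k \<Longrightarrow> F xs = (real (a xs) - real (b xs)) / real (c xs)"
    using real_recursiveE[OF assms(1)] by blast
  obtain a' b' c' where G: "recursive k a'" "recursive k b'" "recursive k c'"
    "\<And>xs. length xs = k \<Longrightarrow> c' xs > 0"
    "\<And>xs. length xs = k \<Longrightarrow> G xs = (real (a' xs) - real (b' xs)) / real (c' xs)"
    using real_recursiveE[OF assms(2)] by blast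
  have "decidable k (\<lambda>xs. a xs * c' xs + b' xs * c xs < a' xs * c xs + b xs * c' xs)"
    by (intro rec_intros F G)
  then show ?thesis
    unfolding decidable_def
  proof (rule recursive_cong)
    fix xs :: "nat list"
    assume xs: "length xs = k"
    have "F xs < G xs \<longleftrightarrow>
      real (a xs * c' xs + b' xs * c xs) < real (a' xs * c xs + b xs * c' xs)"
      using F(4)[OF xs] G(4)[OF xs]
      by (simp add: F(5)[OF xs] G(5)[OF xs] pos_divide_less_eq pos_less_divide_eq)
        (simp add: field_simps)
    then show "of_bool (a xs * c' xs + b' xs * c xs < a' xs * c xs + b xs * c' xs) =
      (of_bool (F xs < G xs) :: nat)" by (simp only: of_nat_less_iff)
  qed
qed

lemma real_recursive_sum [rec_intros]:
  assumes "real_recursive (Suc k) (\<lambda>ys. F (ys ! 0) (tl ys))" "recursive k n"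
  shows "real_recursive k (\<lambda>xs. \<Sum>i<n xs. F i xs)"
proof -
  obtain a b c where F: "recursive (Suc k) a" "recursive (Suc k) b" "recursive (Suc k) c"
    "\<And>ys. length ys = Suc k \<Longrightarrow> c ys > 0"
    "\<And>ys. length ys = Suc k \<Longrightarrow> F (ys ! 0) (tl ys) = (real (a ys) - real (b ys)) / real (c ys)"
    using real_recursiveE[OF assms(1)] by blast
  \<comment> \<open>\<open>C\<close> is the running common denominator; \<open>N a\<close> and
    \<open>N b\<close> are the positive and negative parts of the numerator over it.\<close>
  define C where "C m xs = rec_nat 1 (\<lambda>i y. y * c (i # xs)) m" for m xs
  define N where "N d m xs = rec_nat 0 (\<lambda>i y. y * c (i # xs) + d (i # xs) * C i xs) m" for d m xs
  have "recursive (Suc k) (\<lambda>ys. C (ys ! 0) (tl ys))"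
    unfolding C_def using recursive_Cons_tl_tl[OF recursive_Cons_tl_tl[OF F(3)]]
    by (intro recursive_rec_nat recursive_const recursive_proj recursive_mult) auto
  then have C_rec: "recursive (Suc (Suc k)) (\<lambda>ys. C (ys ! 0) (tl (tl ys)))"
    using recursive_Cons_tl_tl by fastforce
  show ?thesis
  proof (rule real_recursiveI)
    show "recursive k (\<lambda>xs. N a (n xs) xs)" "recursive k (\<lambda>xs. N b (n xs) xs)"
      unfolding N_def
      using recursive_Cons_tl_tl[OF F(1)] recursive_Cons_tl_tl[OF F(2)]
        recursive_Cons_tl_tl[OF F(3)]
      by (intro recursive_rec_nat recursive_const recursive_proj recursive_mult recursive_add
          C_rec assms(2); simp)+
    show "recursive k (\<lambda>xs. C (n xs) xs)"
      unfolding C_def using recursive_Cons_tl_tl[OF F(3)]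
      by (intro recursive_rec_nat recursive_const recursive_proj recursive_mult assms(2)) auto
  next
    fix xs :: "nat list"
    assume xs: "length xs = k"
    have "C m xs > 0 \<and> (\<Sum>i<m. F i xs) = (real (N a m xs) - real (N b m xs)) / real (C m xs)" for m
    proof (induction m)
      case (Suc m)
      have c: "c (m # xs) > 0"
        "F m xs = (real (a (m # xs)) - real (b (m # xs))) / real (c (m # xs))"
        using F(4,5)[of "m # xs"] xs by auto
      have step: "C (Suc m) xs = C m xs * c (m # xs)"
        "N d (Suc m) xs = N d m xs * c (m # xs) + d (m # xs) * C m xs" for d
        by (auto simp: C_def N_def)
      have "(\<Sum>i<Suc m. F i xs) = (real (N a m xs) - real (N b m xs)) / real (C m xs) +
        (real (a (m # xs)) - real (b (m # xs))) / real (c (m # xs))"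
        using Suc c(2) by simp
      also have "\<dots> = (real (N a (Suc m) xs) - real (N b (Suc m) xs)) / real (C (Suc m) xs)"
        using Suc c(1) by (simp add: step add_frac_eq algebra_simps)
      finally show ?case using Suc c(1) step(1) by simp
    qed (simp add: C_def N_def)
    then show "C (n xs) xs > 0 \<and>
      (\<Sum>i<n xs. F i xs) = (real (N a (n xs) xs) - real (N b (n xs) xs)) / real (C (n xs) xs)" .
  qed
qed

lemma real_recursive_power [rec_intros]:
  assumes "recursive k f"
  shows "real_recursive k (\<lambda>xs. (1 / 2) ^ f xs)"
proof (rule real_recursive_cong)
  show "real_recursive k (\<lambda>xs. 1 / real (2 ^ f xs))" by (intro rec_intros assms)
qed (simp add: power_one_over)

lemma real_recursive_int_decode:
  assumes "recursive k f"
  shows "real_recursive k (\<lambda>xs. real_of_int (int_decode (f xs)))"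
proof (rule real_recursive_cong)
  show "real_recursive k (\<lambda>xs. if odd (f xs) then - real (f xs div 2) - 1 else real (f xs div 2))"
    by (intro rec_intros assms)
qed (simp add: int_decode_def sum_decode_def)

lemma real_recursive_nat_to_rat_surj [rec_intros]:
  assumes "recursive k f"
  shows "real_recursive k (\<lambda>xs. of_rat (nat_to_rat_surj (f xs)))"
proof (rule real_recursive_cong)
  show "real_recursive k (\<lambda>xs. real_of_int (int_decode (fst (prod_decode (f xs)))) /
      real_of_int (int_decode (snd (prod_decode (f xs)))))"
    by (intro real_recursive_divide real_recursive_int_decode rec_intros assms)
  show "real_of_int (int_decode (fst (prod_decode (f xs)))) /
      real_of_int (int_decode (snd (prod_decode (f xs)))) = of_rat (nat_to_rat_surj (f xs))" for xs
    \<comment> \<open>For denominator 0 both sides are 0, by the conventions for real division and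
      for the numbering.\<close>
    by (cases "int_decode (snd (prod_decode (f xs))) = 0")
      (auto simp: nat_to_rat_surj_def case_prod_unfold Let_def of_rat_rat rat_number_collapse)
qed

section \<open>The weighted sum of a sequence of cuts\<close>

text \<open>Two numberings, because the terms live in the unit interval while the cut of the sum is
  taken on the whole line. In the application \<open>\<psi>\<close> is \<open>\<theta>\<close>
  followed by the compression, on the same codes.\<close>

locale unit_interval_sequence =
  fixes u :: "nat \<Rightarrow> real" and \<psi> \<theta> :: "nat \<Rightarrow> real"
  assumes u_range: "0 < u n" "u n < 1"
    and \<psi>_range: "0 \<le> \<psi> p" "\<psi> p \<le> 1"
    and \<psi>_dense: "0 \<le> x \<Longrightarrow> x < y \<Longrightarrow> y \<le> 1 \<Longrightarrow> \<exists>p. x < \<psi> p \<and> \<psi> p < y"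
    and \<theta>_dense: "x < y \<Longrightarrow> \<exists>c. x < \<theta> c \<and> \<theta> c < y"
    and \<psi>_recursive: "recursive k f \<Longrightarrow> real_recursive k (\<lambda>xs. \<psi> (f xs))"
    and \<theta>_recursive: "recursive k f \<Longrightarrow> real_recursive k (\<lambda>xs. \<theta> (f xs))"
    and uniformly_ce_upper: "uniformly_ce (\<lambda>n. {p. u n < \<psi> p})"
begin

definition w :: "nat \<Rightarrow> real" where "w n = (1 / 2) ^ Suc n"

definition s :: real where "s = (\<Sum>n. w n * u n)"

abbreviation J :: "nat set" where "J \<equiv> join (\<lambda>n. {p. \<psi> p < u n})"

lemma w_pos: "w n > 0"
  by (simp add: w_def)

lemma sum_w: "(\<Sum>m<n. w m) = 1 - (1 / 2) ^ n"
  by (induction n) (auto simp: w_def)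

lemma summable_w: "summable w"
  unfolding w_def using summable_geometric[of "1 / 2 :: real"]
  by (intro summable_Suc_iff[THEN iffD2]) auto

lemma summable_w_u: "summable (\<lambda>n. w n * u n)"
  by (rule summable_comparison_test'[OF summable_w, of 0])
    (use u_range w_pos in \<open>auto simp: abs_mult less_imp_le mult_left_le\<close>)

lemma sum_le_s: "(\<Sum>m<n. w m * u m) \<le> s"
  unfolding s_def using u_range w_pos by (intro sum_le_suminf summable_w_u) (auto simp: less_imp_le)

text \<open>The terms \<open>w m * (1 - u m)\<close> are nonnegative, so their partial sums
  increase. Subtracting them from the partial sums of \<open>w\<close> bounds what is added after
  \<open>n\<close> by the remaining weight.\<close>

lemma s_le_sum: "s \<le> (\<Sum>m<n. w m * u m) + (1 / 2) ^ n"
proof (rule LIMSEQ_le_const2)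
  show "(\<lambda>N. \<Sum>m<N. w m * u m) \<longlonglongrightarrow> s"
    unfolding s_def by (rule summable_LIMSEQ[OF summable_w_u])
  have "(\<Sum>m<N. w m * u m) \<le> (\<Sum>m<n. w m * u m) + (1 / 2) ^ n" if "n \<le> N" for N
  proof -
    have "(\<Sum>m<N. w m * (1 - u m)) \<ge> (\<Sum>m<n. w m * (1 - u m))"
      using that u_range w_pos by (intro sum_mono2) (auto simp: less_imp_le)
    then have "(\<Sum>m<n. w m) - (\<Sum>m<n. w m * u m) \<le> (\<Sum>m<N. w m) - (\<Sum>m<N. w m * u m)"
      by (simp add: right_diff_distrib sum_subtractf)
    moreover have "(0 :: real) \<le> (1 / 2) ^ N" by simp
    ultimately show ?thesis unfolding sum_w by linarith
  qed
  then show "\<exists>M. \<forall>N\<ge>M. (\<Sum>m<N. w m * u m) \<le> (\<Sum>m<n. w m * u m) + (1 / 2) ^ n" by blast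
qed

section \<open>Lower bounds for the sum from finite sets of guesses\<close>

text \<open>The disjunct \<open>p = d\<close> makes the search total. It does not affect the result if \<open>d\<close> codes a set
  containing some \<open>\<langle>m, p\<rangle>\<close>, as then \<open>p < d\<close>.\<close>

definition pick :: "nat \<Rightarrow> nat \<Rightarrow> nat" where
  "pick m d = (LEAST p. p = d \<or> prod_encode (m, p) \<in> set_decode d)"

lemma set_decode_less: "i \<in> set_decode d \<Longrightarrow> i < d"
proof -
  assume "i \<in> set_decode d"
  then have "d div 2 ^ i \<noteq> 0" by (auto simp: set_decode_def intro: ccontr)
  then have "2 ^ i \<le> d" by (metis div_less not_le)
  then show "i < d" using less_exp[of i] by linarith
qed

lemma pick_recursive [rec_intros]:
  assumes "recursive k f" "recursive k g"
  shows "recursive k (\<lambda>xs. pick (f xs) (g xs))"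
  unfolding pick_def using assms[THEN recursive_tl] by (intro rec_intros) auto

text \<open>One number is both a finite set of guesses and the length of a sum. The bound
  \<open>N \<le> d\<close> holds since each \<open>m < N\<close> is at most the code of its pair,
  which as an element of the coded set is below \<open>d\<close>.\<close>

lemma finite_choice_code:
  obtains d where "N \<le> d" "\<And>m q. prod_encode (m, q) \<in> set_decode d \<longleftrightarrow> m < N \<and> q = p m"
    "\<And>m. m < N \<Longrightarrow> pick m d = p m"
proof
  define d where "d = set_encode ((\<lambda>m. prod_encode (m, p m)) ` {..<N})"
  show D: "prod_encode (m, q) \<in> set_decode d \<longleftrightarrow> m < N \<and> q = p m" for m q
    unfolding d_def by auto
  have less: "m < d \<and> p m < d" if "m < N" for m
    using that set_decode_less[of "prod_encode (m, p m)" d] le_prod_encode_1[of m "p m"]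
      le_prod_encode_2[of "p m" m] D[of m "p m"] by linarith
  then show "N \<le> d" by (meson less_irrefl not_le)
  show "pick m d = p m" if "m < N" for m
    unfolding pick_def by (rule Least_equality) (use that less[OF that] D in auto)
qed

text \<open>The default 0 lies below every \<open>u m\<close>. A guess needs no test here, as it is
  certified by the oracle when \<open>d\<close> codes a subset of \<open>J\<close>.\<close>

definition lower :: "nat \<Rightarrow> nat \<Rightarrow> real" where
  "lower m d = (if prod_encode (m, pick m d) \<in> set_decode d then \<psi> (pick m d) else 0)"

definition lower_sum :: "nat \<Rightarrow> real" where
  "lower_sum d = (\<Sum>m<d. w m * lower m d)"

lemma lower_sum_le:
  assumes "set_decode d \<subseteq> J"
  shows "lower_sum d \<le> s"
proof -
  have "lower m d \<le> u m" for m
    using assms u_range[of m] unfolding lower_def join_def by (auto simp: less_imp_le)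
  then have "lower_sum d \<le> (\<Sum>m<d. w m * u m)"
    unfolding lower_sum_def using w_pos by (intro sum_mono mult_left_mono) (auto simp: less_imp_le)
  then show ?thesis using sum_le_s[of d] by linarith
qed

lemma half_power_less:
  assumes "\<epsilon> > (0 :: real)"
  obtains N where "n < N" "(1 / 2) ^ N < \<epsilon>"
proof -
  obtain N where "(1 / 2 :: real) ^ N < \<epsilon>" using real_arch_pow_inv[OF assms, of "1 / 2"] by auto
  moreover have "(1 / 2 :: real) ^ max N (Suc n) \<le> (1 / 2) ^ N" by (intro power_decreasing) auto
  ultimately have "(1 / 2) ^ max N (Suc n) < \<epsilon>" by (rule le_less_trans[rotated])
  then show thesis by (intro that[of "max N (Suc n)"]) auto
qed

lemma sum_w_add_le:
  assumes "\<epsilon> \<ge> 0"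
  shows "(\<Sum>m<N. w m * (u m + \<epsilon>)) \<le> (\<Sum>m<N. w m * u m) + \<epsilon>"
proof -
  have "(\<Sum>m<N. w m * (u m + \<epsilon>)) = (\<Sum>m<N. w m * u m) + (\<Sum>m<N. w m) * \<epsilon>"
    by (simp add: distrib_left sum.distrib sum_distrib_right)
  moreover have "(\<Sum>m<N. w m) * \<epsilon> \<le> 1 * \<epsilon>"
    using assms by (intro mult_right_mono) (auto simp: sum_w)
  ultimately show ?thesis by simp
qed

lemma lower_sum_approx:
  assumes "x < s"
  shows "\<exists>d. set_decode d \<subseteq> J \<and> x < lower_sum d"
proof -
  \<comment> \<open>Half of the gap pays for cutting the series at \<open>N\<close>, half for the
    errors of the guesses, which add up to at most \<open>\<epsilon>\<close> because the weights sum
    to at most 1.\<close>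
  define \<epsilon> where "\<epsilon> = (s - x) / 2"
  have \<epsilon>: "\<epsilon> > 0" using assms by (simp add: \<epsilon>_def)
  obtain N where N: "(1 / 2) ^ N < \<epsilon>" using half_power_less[OF \<epsilon>] by metis
  \<comment> \<open>The maximum keeps the interval inside the range on which \<open>\<psi>\<close>
    is assumed dense.\<close>
  have "\<exists>q. max 0 (u m - \<epsilon>) < \<psi> q \<and> \<psi> q < u m" for m
    using u_range[of m] \<epsilon> by (intro \<psi>_dense) auto
  then obtain p where p: "\<And>m. u m - \<epsilon> < \<psi> (p m)" "\<And>m. \<psi> (p m) < u m"
    by (metis max_less_iff_conj)
  obtain d where d: "N \<le> d" "\<And>m q. prod_encode (m, q) \<in> set_decode d \<longleftrightarrow> m < N \<and> q = p m"
    "\<And>m. m < N \<Longrightarrow> pick m d = p m" using finite_choice_code[of N p] by blast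
  have "i \<in> J" if "i \<in> set_decode d" for i
    using that d(2)[of "fst (prod_decode i)" "snd (prod_decode i)"] p(2)
    unfolding join_def
    by (metis (mono_tags, lifting) mem_Collect_eq prod.collapse prod_decode_inverse)
  moreover have "x < lower_sum d"
  proof -
    have "(\<Sum>m<N. w m * u m) \<le> (\<Sum>m<N. w m * (\<psi> (p m) + \<epsilon>))"
      using w_pos p(1) by (intro sum_mono mult_left_mono) (auto simp: less_imp_le algebra_simps)
    also have "\<dots> \<le> (\<Sum>m<N. w m * \<psi> (p m)) + \<epsilon>"
    proof -
      have "(\<Sum>m<N. w m) * \<epsilon> \<le> 1 * \<epsilon>" using \<epsilon> by (intro mult_right_mono) (auto simp: sum_w)
      then show ?thesis by (simp add: distrib_left sum.distrib sum_distrib_right)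
    qed
    also have "(\<Sum>m<N. w m * \<psi> (p m)) = (\<Sum>m<N. w m * lower m d)"
      using d by (intro sum.cong) (auto simp: lower_def)
    also have "\<dots> \<le> lower_sum d"
      unfolding lower_sum_def using d(1) w_pos \<psi>_range
      by (intro sum_mono2) (auto simp: lower_def less_imp_le)
    finally have "(\<Sum>m<N. w m * u m) \<le> lower_sum d + \<epsilon>" by simp
    then show ?thesis using s_le_sum[of N] N unfolding \<epsilon>_def by argo
  qed
  ultimately show ?thesis by blast
qed

text \<open>Unlike in \<open>lower\<close>, the set coded by \<open>d\<close> is arbitrary here: a
  guess counts only after the enumeration has confirmed it by stage \<open>t\<close>, and 1 stands
  in until then.\<close>

definition upper :: "(nat \<Rightarrow> nat \<Rightarrow> nat \<Rightarrow> bool) \<Rightarrow> nat \<Rightarrow> nat \<Rightarrow> nat \<Rightarrow> real" where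
  "upper en t m d =
    (if prod_encode (m, pick m d) \<in> set_decode d \<and> en t m (pick m d) then \<psi> (pick m d) else 1)"

text \<open>The added power is the total weight of the terms from \<open>d\<close> on, each bounded
  by 1.\<close>

definition upper_sum :: "(nat \<Rightarrow> nat \<Rightarrow> nat \<Rightarrow> bool) \<Rightarrow> nat \<Rightarrow> nat \<Rightarrow> real" where
  "upper_sum en t d = (\<Sum>m<d. w m * upper en t m d) + (1 / 2) ^ d"

context
  fixes en :: "nat \<Rightarrow> nat \<Rightarrow> nat \<Rightarrow> bool"
  assumes en_iff: "\<And>n p. (\<exists>t. en t n p) \<longleftrightarrow> u n < \<psi> p"
    and en_eventually: "\<And>n p. u n < \<psi> p \<Longrightarrow> \<forall>\<^sub>F t in sequentially. en t n p"
    and en_recursive: "\<And>k t n x. recursive k t \<Longrightarrow> recursive k n \<Longrightarrow> recursive k x \<Longrightarrow>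
      decidable k (\<lambda>xs. en (t xs) (n xs) (x xs))"
begin

lemma upper_ge: "u m \<le> upper en t m d"
  using u_range[of m] en_iff[of m "pick m d"] by (auto simp: upper_def less_imp_le)

lemma upper_sum_ge: "s \<le> upper_sum en t d"
proof -
  have "(\<Sum>m<d. w m * u m) \<le> (\<Sum>m<d. w m * upper en t m d)"
    using w_pos upper_ge by (intro sum_mono mult_left_mono) (auto simp: less_imp_le)
  then show ?thesis using s_le_sum[of d] unfolding upper_sum_def by linarith
qed

text \<open>The error of the \<open>n\<close>-th term is one of the nonnegative errors that make up
  the total error, so removing that term leaves an upper bound for the rest of the series. The
  hypothesis \<open>n < d\<close> ensures that the term is present.\<close>

lemma upper_sum_diff_ge:
  assumes "n < d"
  shows "s - w n * u n \<le> upper_sum en t d - w n * upper en t n d"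
proof -
  have "w n * (upper en t n d - u n) \<le> (\<Sum>m<d. w m * (upper en t m d - u m))"
    using w_pos upper_ge assms by (intro member_le_sum) (auto simp: less_imp_le)
  then show ?thesis using s_le_sum[of d]
    by (simp add: upper_sum_def right_diff_distrib sum_subtractf)
qed

text \<open>The free \<open>n\<close> allows the approximation to include any prescribed term, as
  \<open>join_iff\<close> requires.\<close>

lemma upper_sum_approx:
  assumes "s < x"
  shows "\<exists>t d. n < d \<and> upper_sum en t d < x"
proof -
  define \<epsilon> where "\<epsilon> = (x - s) / 2"
  have \<epsilon>: "\<epsilon> > 0" using assms by (simp add: \<epsilon>_def)
  obtain N where N: "n < N" "(1 / 2) ^ N < \<epsilon>" using half_power_less[OF \<epsilon>] by metis
  have "\<exists>q. u m < \<psi> q \<and> \<psi> q < min 1 (u m + \<epsilon>)" for m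
    using u_range[of m] \<epsilon> by (intro \<psi>_dense) auto
  then obtain p where p: "\<And>m. u m < \<psi> (p m)" "\<And>m. \<psi> (p m) < u m + \<epsilon>"
    by (metis min_less_iff_conj)
  obtain d where d: "N \<le> d" "\<And>m q. prod_encode (m, q) \<in> set_decode d \<longleftrightarrow> m < N \<and> q = p m"
    "\<And>m. m < N \<Longrightarrow> pick m d = p m" using finite_choice_code[of N p] by blast
  have "\<forall>\<^sub>F t in sequentially. \<forall>m\<in>{..<N}. en t m (p m)"
    using p(1) by (intro eventually_ball_finite ballI en_eventually) auto
  then obtain t where t: "\<And>m. m < N \<Longrightarrow> en t m (p m)"
    using eventually_happens'[OF sequentially_bot] by blast
  have "(\<Sum>m<d. w m * upper en t m d) =
    (\<Sum>m<N. w m * upper en t m d) + (\<Sum>m\<in>{N..<d}. w m * upper en t m d)"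
    using d(1) by (simp flip: sum.atLeastLessThan_concat[of 0 N d] atLeast0LessThan)
  \<comment> \<open>There are no guesses from \<open>N\<close> on, so these terms take the default
    1. Their weight and the final \<open>(1 / 2) ^ d\<close> add up to \<open>(1 / 2) ^ N\<close>,
    and the uncontrolled size of \<open>d\<close> cancels.\<close>
  also have "(\<Sum>m\<in>{N..<d}. w m * upper en t m d) = (\<Sum>m\<in>{N..<d}. w m)"
    using d(2) by (intro sum.cong) (auto simp: upper_def)
  also have "\<dots> = (\<Sum>m<d. w m) - (\<Sum>m<N. w m)"
    using d(1) by (simp flip: sum.atLeastLessThan_concat[of 0 N d] atLeast0LessThan)
  also have "\<dots> = (1 / 2) ^ N - (1 / 2) ^ d" by (simp add: sum_w)
  also have "(\<Sum>m<N. w m * upper en t m d) \<le> (\<Sum>m<N. w m * (u m + \<epsilon>))"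
    using w_pos p d t by (intro sum_mono mult_left_mono) (auto simp: upper_def less_imp_le)
  also have "\<dots> \<le> (\<Sum>m<N. w m * u m) + \<epsilon>" using \<epsilon> by (intro sum_w_add_le) simp
  finally have "upper_sum en t d \<le> (\<Sum>m<N. w m * u m) + \<epsilon> + (1 / 2) ^ N"
    by (simp add: upper_sum_def)
  also have "\<dots> < x" using sum_le_s[of N] N(2) unfolding \<epsilon>_def by argo
  finally show ?thesis using N(1) d(1) by (meson less_le_trans)
qed

text \<open>If \<open>\<psi> p < u n\<close>, the slack \<open>w n * (u n - \<psi> p)\<close> lets
  an upper sum be chosen so close to \<open>s\<close> that the replacement falls below
  \<open>s\<close>; the removed term need only be at least \<open>w n * u n\<close>. Conversely the
  remaining terms bound \<open>s - w n * u n\<close> from above, so a total below \<open>s\<close>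
  forces \<open>\<psi> p < u n\<close>.\<close>

lemma join_iff:
  "prod_encode (n, p) \<in> J \<longleftrightarrow> (\<exists>c\<in>{c. \<theta> c < s}. \<exists>t d. n < d \<and>
     upper_sum en t d - w n * upper en t n d + w n * \<psi> p < \<theta> c)"
proof -
  have "\<psi> p < u n \<longleftrightarrow> (\<exists>c\<in>{c. \<theta> c < s}. \<exists>t d. n < d \<and>
     upper_sum en t d - w n * upper en t n d + w n * \<psi> p < \<theta> c)"
  proof
    assume "\<psi> p < u n"
    then have "s < s + w n * (u n - \<psi> p)" using w_pos by simp
    then obtain t d where td: "n < d" "upper_sum en t d < s + w n * (u n - \<psi> p)"
      using upper_sum_approx by blast
    moreover have "w n * u n \<le> w n * upper en t n d"
      using w_pos upper_ge by (intro mult_left_mono) (auto simp: less_imp_le)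
    ultimately have "upper_sum en t d - w n * upper en t n d + w n * \<psi> p < s"
      by (simp add: right_diff_distrib)
    with td(1) show "\<exists>c\<in>{c. \<theta> c < s}. \<exists>t d. n < d \<and>
       upper_sum en t d - w n * upper en t n d + w n * \<psi> p < \<theta> c"
      using \<theta>_dense by blast
  next
    assume "\<exists>c\<in>{c. \<theta> c < s}. \<exists>t d. n < d \<and>
       upper_sum en t d - w n * upper en t n d + w n * \<psi> p < \<theta> c"
    then obtain c t d where "n < d" "\<theta> c < s"
      "upper_sum en t d - w n * upper en t n d + w n * \<psi> p < \<theta> c" by blast
    with upper_sum_diff_ge[of n d t] have "w n * \<psi> p < w n * u n" by linarith
    then show "\<psi> p < u n" using w_pos by simp
  qed
  then show ?thesis unfolding join_def by simp
qed

section \<open>Recursiveness of the bounds and the two reductions\<close>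

lemma w_recursive: "recursive k f \<Longrightarrow> real_recursive k (\<lambda>xs. w (f xs))"
  unfolding w_def by (intro rec_intros)

lemma lower_recursive:
  "recursive k f \<Longrightarrow> recursive k g \<Longrightarrow> real_recursive k (\<lambda>xs. lower (f xs) (g xs))"
  unfolding lower_def by (intro rec_intros \<psi>_recursive)

lemma lower_sum_recursive: "recursive k f \<Longrightarrow> real_recursive k (\<lambda>xs. lower_sum (f xs))"
  unfolding lower_sum_def
  by (intro rec_intros w_recursive lower_recursive recursive_tl) simp_all

lemma upper_recursive:
  "recursive k f \<Longrightarrow> recursive k g \<Longrightarrow> recursive k h \<Longrightarrow>
    real_recursive k (\<lambda>xs. upper en (f xs) (g xs) (h xs))"
  unfolding upper_def by (intro rec_intros \<psi>_recursive en_recursive)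

lemma upper_sum_recursive:
  assumes "recursive k f" "recursive k g"
  shows "real_recursive k (\<lambda>xs. upper_sum en (f xs) (g xs))"
  unfolding upper_sum_def using assms[THEN recursive_tl]
  by (intro rec_intros w_recursive upper_recursive assms) simp_all

lemma ce_above_s: "ce {c. s < \<theta> c}"
proof -
  have "ce {c. \<exists>t d. upper_sum en t d < \<theta> c}"
    by (intro ce_projection2 decidable_real_less upper_sum_recursive \<theta>_recursive)
  moreover have "s < \<theta> c \<longleftrightarrow> (\<exists>t d. upper_sum en t d < \<theta> c)" for c
    using upper_sum_approx upper_sum_ge by (meson le_less_trans)
  ultimately show ?thesis by simp
qed

lemma join_reducible_below_s: "enum_reducible J {c. \<theta> c < s}"
proof -
  let ?P = "\<lambda>t d c z. fst (prod_decode z) < d \<and>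
    upper_sum en t d - w (fst (prod_decode z)) * upper en t (fst (prod_decode z)) d +
      w (fst (prod_decode z)) * \<psi> (snd (prod_decode z)) < \<theta> c"
  have "enum_reducible {z. \<exists>c\<in>{c. \<theta> c < s}. \<exists>t d. ?P t d c z} {c. \<theta> c < s}"
    by (intro enum_reducible_element rec_intros upper_sum_recursive upper_recursive w_recursive
        \<psi>_recursive \<theta>_recursive)
  moreover have "z \<in> J \<longleftrightarrow> (\<exists>c\<in>{c. \<theta> c < s}. \<exists>t d. ?P t d c z)" for z
    using join_iff[of "fst (prod_decode z)" "snd (prod_decode z)"] by simp
  then have "J = {z. \<exists>c\<in>{c. \<theta> c < s}. \<exists>t d. ?P t d c z}" by blast
  ultimately show ?thesis by metis
qed

text \<open>This direction consults a whole finite set of oracle elements, as a lower sum mixes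
  several cuts. The canonical index of the set is itself the argument of \<open>lower_sum\<close>,
  which makes the axioms decidable.\<close>

lemma below_s_reducible_join: "enum_reducible {c. \<theta> c < s} J"
proof -
  have "enum_reducible {c. \<exists>D. finite D \<and> D \<subseteq> J \<and> \<theta> c < lower_sum (set_encode D)} J"
    by (intro enum_reducible_finite_set decidable_real_less lower_sum_recursive \<theta>_recursive)
  moreover have "\<theta> c < s \<longleftrightarrow> (\<exists>D. finite D \<and> D \<subseteq> J \<and> \<theta> c < lower_sum (set_encode D))" for c
  proof
    assume "\<theta> c < s"
    then show "\<exists>D. finite D \<and> D \<subseteq> J \<and> \<theta> c < lower_sum (set_encode D)"
      using lower_sum_approx by (metis finite_set_decode set_decode_inverse)
  next
    assume "\<exists>D. finite D \<and> D \<subseteq> J \<and> \<theta> c < lower_sum (set_encode D)"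
    then show "\<theta> c < s" using lower_sum_le by (metis set_encode_inverse less_le_trans)
  qed
  ultimately show ?thesis by simp
qed

end

lemma exists_ce_sum:
  "\<exists>s. ce {c. s < \<theta> c} \<and> enum_equivalent (join (\<lambda>n. {p. \<psi> p < u n})) {c. \<theta> c < s}"
proof -
  obtain en where
    "\<And>k t n x. recursive k t \<Longrightarrow> recursive k n \<Longrightarrow> recursive k x \<Longrightarrow>
      decidable k (\<lambda>xs. en (t xs) (n xs) (x xs))"
    "\<And>n x. (\<exists>t. en t n x) \<longleftrightarrow> x \<in> {p. u n < \<psi> p}"
    "\<And>n x. x \<in> {p. u n < \<psi> p} \<Longrightarrow> \<forall>\<^sub>F t in sequentially. en t n x"
    using uniformly_ce_enumeration[OF uniformly_ce_upper] by blast
  then show ?thesis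
    unfolding enum_equivalent_def
    using ce_above_s[of en] join_reducible_below_s[of en] below_s_reducible_join[of en] by auto
qed

end

section \<open>Compression of the real line into the unit interval\<close>

definition squash :: "real \<Rightarrow> real" where
  "squash x = (1 + x / (1 + \<bar>x\<bar>)) / 2"

lemma squash_range: "0 < squash x" "squash x < 1"
  by (auto simp: squash_def field_simps abs_if)

lemma squash_less_iff [simp]: "squash x < squash y \<longleftrightarrow> x < y"
proof -
  have less: "squash x < squash y" if "x < y" for x y
  proof -
    have "0 < 1 + \<bar>x\<bar>" "0 < 1 + \<bar>y\<bar>" by linarith+
    moreover have "x * (1 + \<bar>y\<bar>) < y * (1 + \<bar>x\<bar>)"
    proof (cases "x < 0 \<and> 0 < y")
      case True
      then have "x * y < 0" by (simp add: mult_neg_pos)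
      with True that show ?thesis by (simp add: algebra_simps)
    next
      case False
      with that show ?thesis by (auto simp: abs_if algebra_simps)
    qed
    ultimately have "x / (1 + \<bar>x\<bar>) < y / (1 + \<bar>y\<bar>)" by (simp add: divide_simps)
    then show ?thesis unfolding squash_def by argo
  qed
  show ?thesis using less[of x y] less[of y x] by (cases x y rule: linorder_cases) auto
qed

lemma squash_surj:
  assumes "0 < y" "y < 1"
  obtains x where "squash x = y"
proof
  \<comment> \<open>This undoes the affine part; \<open>z / (1 - \<bar>z\<bar>)\<close> then inverts
    \<open>x / (1 + \<bar>x\<bar>)\<close>.\<close>
  define z where "z = 2 * y - 1"
  have z: "\<bar>z\<bar> < 1" using assms by (auto simp: z_def)
  have "1 + \<bar>z / (1 - \<bar>z\<bar>)\<bar> = 1 / (1 - \<bar>z\<bar>)" using z by (simp add: abs_divide field_simps)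
  then have "squash (z / (1 - \<bar>z\<bar>)) = (1 + z) / 2" using z by (simp add: squash_def)
  then show "squash (z / (1 - \<bar>z\<bar>)) = y" by (simp add: z_def)
qed

lemma squash_dense:
  assumes "0 \<le> x" "x < y" "y \<le> 1"
    and dense: "\<And>a b. a < b \<Longrightarrow> \<exists>c. a < \<theta> c \<and> \<theta> c < b"
  shows "\<exists>c. x < squash (\<theta> c) \<and> squash (\<theta> c) < y"
proof -
  \<comment> \<open>The points at one and two thirds lie strictly inside (0, 1) even if
    \<open>x = 0\<close> or \<open>y = 1\<close>, so they have preimages.\<close>
  obtain a where a: "squash a = (2 * x + y) / 3"
    by (rule squash_surj[of "(2 * x + y) / 3"]) (use assms(1-3) in auto)
  obtain b where b: "squash b = (x + 2 * y) / 3"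
    by (rule squash_surj[of "(x + 2 * y) / 3"]) (use assms(1-3) in auto)
  have "squash a < squash b" unfolding a b using assms(2) by simp
  then have "a < b" by simp
  then obtain c where "a < \<theta> c" "\<theta> c < b" using dense by blast
  then have "squash a < squash (\<theta> c)" "squash (\<theta> c) < squash b" by auto
  with assms(2) show ?thesis unfolding a b by (intro exI[of _ c] conjI) argo+
qed

text \<open>The choice of a piecewise rational compression pays off here: it turns computable
  fractions into computable fractions.\<close>

lemma real_recursive_squash:
  assumes "real_recursive k F"
  shows "real_recursive k (\<lambda>xs. squash (F xs))"
proof (rule real_recursive_cong)
  show "real_recursive k (\<lambda>xs. (1 + F xs / (1 + (if F xs < 0 then - F xs else F xs))) / 2)"
    by (intro rec_intros assms)
qed (simp add: squash_def abs_if)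

text \<open>Since \<open>squash\<close> is strictly increasing, the cut of
  \<open>squash (r n)\<close> under the compressed numbering is the same set of codes as the cut of
  \<open>r n\<close>, and no recoding occurs.\<close>

lemma exists_ce_equivalent:
  fixes \<theta> :: "nat \<Rightarrow> real" and r :: "nat \<Rightarrow> real"
  assumes "\<And>a b. a < b \<Longrightarrow> \<exists>c. a < \<theta> c \<and> \<theta> c < b"
    and "\<And>k f. recursive k f \<Longrightarrow> real_recursive k (\<lambda>xs. \<theta> (f xs))"
    and "uniformly_ce (\<lambda>n. {p. r n < \<theta> p})"
  shows "\<exists>s. ce {c. s < \<theta> c} \<and> enum_equivalent (join (\<lambda>n. {p. \<theta> p < r n})) {c. \<theta> c < s}"
proof -
  interpret unit_interval_sequence "\<lambda>n. squash (r n)" "\<lambda>p. squash (\<theta> p)" \<theta>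
    using assms squash_range squash_dense[OF _ _ _ assms(1)]
    by unfold_locales (auto intro: real_recursive_squash less_imp_le)
  show ?thesis using exists_ce_sum by simp
qed

lemma nat_to_rat_surj_dense:
  "a < b \<Longrightarrow> \<exists>c. a < real_of_rat (nat_to_rat_surj c) \<and> real_of_rat (nat_to_rat_surj c) < b"
  using of_rat_dense[of a b] surj_nat_to_rat_surj by (metis surjD)

theorem theorem4p1:
  fixes r :: "nat \<Rightarrow> real"
  shows "(uniformly_right_ce r \<longrightarrow>
      (\<exists>s. right_ce s \<and>
        enum_equivalent (join (\<lambda>n. rat_codes (left_cut (r n)))) (rat_codes (left_cut s)))) \<and>
    (uniformly_left_ce r \<longrightarrow>
      (\<exists>s. left_ce s \<and>
        enum_equivalent (join (\<lambda>n. rat_codes (right_cut (r n)))) (rat_codes (right_cut s))))"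
proof (intro conjI impI)
  assume "uniformly_right_ce r"
  then show "\<exists>s. right_ce s \<and>
    enum_equivalent (join (\<lambda>n. rat_codes (left_cut (r n)))) (rat_codes (left_cut s))"
    using exists_ce_equivalent[of "\<lambda>c. of_rat (nat_to_rat_surj c)" r]
      nat_to_rat_surj_dense real_recursive_nat_to_rat_surj
    by (simp add: uniformly_right_ce_def right_ce_def rat_codes_def left_cut_def right_cut_def)
next
  assume "uniformly_left_ce r"
  moreover have "\<exists>c. a < - real_of_rat (nat_to_rat_surj c) \<and> - real_of_rat (nat_to_rat_surj c) < b"
    if "a < b" for a b
    using nat_to_rat_surj_dense[of "- b" "- a"] that by (auto simp: minus_less_iff less_minus_iff)
  \<comment> \<open>Negating the values of the numbering turns right cuts of \<open>r n\<close> into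
    left cuts of \<open>- r n\<close> with unchanged codes; the real sought is then
    \<open>- s\<close>.\<close>
  ultimately obtain s :: real where
    "ce {c. s < - real_of_rat (nat_to_rat_surj c)}"
    "enum_equivalent (join (\<lambda>n. {p. - real_of_rat (nat_to_rat_surj p) < - r n}))
      {c. - real_of_rat (nat_to_rat_surj c) < s}"
    using exists_ce_equivalent[of "\<lambda>c. - of_rat (nat_to_rat_surj c)" "\<lambda>n. - r n"]
      real_recursive_minus[OF real_recursive_nat_to_rat_surj]
    by (auto simp: uniformly_left_ce_def rat_codes_def left_cut_def)
  then show "\<exists>s. left_ce s \<and>
    enum_equivalent (join (\<lambda>n. rat_codes (right_cut (r n)))) (rat_codes (right_cut s))"
    by (intro exI[of _ "- s"])
      (simp add: left_ce_def rat_codes_def left_cut_def right_cut_def minus_less_iff less_minus_iff)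
qed

end
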